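(* For $k\in\mathbb{R}$ let $S_k=\{(f,k)\in H_k\mid a(f,k)=0\text{ for some monic }a\in\mathcal{R}\}$. Then for all $k,l\in\mathbb{R}$: (1) $S_k+S_k\subset S_k$; (2) $S_kS_l\subset S_{k+l}$; (3) $\mathcal{R}_kS_l\subset S_{k+l}$; (4) $\mathcal{M}_k\subset S_k$. Consequently $\bigoplus_{k\in\mathbb{R}}S_k$ is a $\mathbb{C}$-subalgebra and a left $\mathcal{R}$-submodule of $H$.
   Context: Let $\mathrm{Hol}$ be the space of holomorphic functions on the upper half plane, $q=e^{2\pi iz}$, $f'=\frac{1}{2\pi i}\frac{df}{dz}$, and $E_2,E_4,E_6$ the Eisenstein series with constant term $1$. For $k\in\mathbb{R}$ let $D_kf=f'-\frac{k}{12}E_2f$. Let $H=\bigoplus_{n\in\mathbb{R}}H_n$ where each $H_n$ is a copy of $\mathrm{Hol}$, elements written $(f,n)$, with product $(f,n)(g,m)=(fg,n+m)$. $\mathrm{End}^i(H)$ denotes the $\mathbb{C}$-linear maps sending each $H_n$ into $H_{n+i}$ and $\mathrm{End}(H)=\bigoplus_i\mathrm{End}^i(H)$. Define $\delta(f,n)=(D_nf,n+2)$, $e_4(f,n)=(E_4f,n+4)$, $e_6(f,n)=(E_6f,n+6)$; $\mathcal{R}=\bigoplus_k\mathcal{R}_k$ is the $\mathbb{C}$-subalgebra of $\mathrm{End}(H)$ generated by $\delta,e_4,e_6$, graded by weight. $\mathcal{M}=\mathbb{C}[E_4,E_6]=\bigoplus_k\mathcal{M}_k$ is the ring of level-one holomorphic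 modular forms, identified with the subalgebra of $\mathcal{R}$ generated by $e_4,e_6$ (and $\mathcal{M}_k\subset H_k$ via $f\mapsto(f,k)$). Every nonzero $a\in\mathcal{R}$ is uniquely $a=a_n\delta^n+\cdots+a_0$ with $a_i\in\mathcal{M}$, $a_n\neq0$; $a$ is monic if $a_n=1$. Products $S_kS_l$ and $\mathcal{R}_kS_l$ mean sets of products $\phi\psi$ in $H$ and of $a\phi$. *)

theory Defs
  imports "HOL-Analysis.Analysis"
begin

definition uhp :: "complex set" where
  "uhp = {z. Im z > 0}"

definition qpar :: "complex \<Rightarrow> complex" where
  "qpar z = exp (2 * of_real pi * \<i> * z)"

definition dsigma :: "nat \<Rightarrow> nat \<Rightarrow> nat" where
  "dsigma j n = (\<Sum>d\<in>{d. d dvd n}. d ^ j)"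

definition E2 :: "complex \<Rightarrow> complex" where
  "E2 z = 1 - 24 * (\<Sum>n. of_nat (dsigma 1 (Suc n)) * qpar z ^ Suc n)"

definition E4 :: "complex \<Rightarrow> complex" where
  "E4 z = 1 + 240 * (\<Sum>n. of_nat (dsigma 3 (Suc n)) * qpar z ^ Suc n)"

definition E6 :: "complex \<Rightarrow> complex" where
  "E6 z = 1 - 504 * (\<Sum>n. of_nat (dsigma 5 (Suc n)) * qpar z ^ Suc n)"

definition qderiv :: "(complex \<Rightarrow> complex) \<Rightarrow> complex \<Rightarrow> complex" where
  "qderiv f z = deriv f z / (2 * of_real pi * \<i>)"

definition serre :: "real \<Rightarrow> (complex \<Rightarrow> complex) \<Rightarrow> complex \<Rightarrow> complex" where
  "serre k f z = qderiv f z - of_real k / 12 * E2 z * f z"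

text \<open>An element of H = (direct sum over n of H_n) is represented by its family of
  components h n (a function on C, of which only the values on the upper half plane
  matter); elements of H proper have finite support.\<close>
type_synonym hel = "real \<Rightarrow> complex \<Rightarrow> complex"
type_synonym hop = "hel \<Rightarrow> hel"

definition Hspace :: "hel set" where
  "Hspace = {h. finite {n. h n \<noteq> (\<lambda>_. 0)}}"

definition hsingle :: "real \<Rightarrow> (complex \<Rightarrow> complex) \<Rightarrow> hel" where
  "hsingle n f = (\<lambda>m. if m = n then f else (\<lambda>_. 0))"

text \<open>Product in H: (f,n)(g,m) = (fg,n+m), extended bilinearly\<close>
definition hmul :: "hel \<Rightarrow> hel \<Rightarrow> hel" where
  "hmul h1 h2 = (\<lambda>n z. \<Sum>m\<in>{m. h1 m \<noteq> (\<lambda>_. 0)}. h1 m z * h2 (n - m) z)"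

definition hone :: hel where
  "hone = hsingle 0 (\<lambda>_. 1)"

text \<open>delta (f,n) = (D_n f, n+2), e4 (f,n) = (E4 f, n+4), e6 (f,n) = (E6 f, n+6)\<close>
definition delta :: hop where
  "delta h = (\<lambda>n. serre (n - 2) (h (n - 2)))"

definition e4 :: hop where
  "e4 h = (\<lambda>n z. E4 z * h (n - 4) z)"

definition e6 :: hop where
  "e6 h = (\<lambda>n z. E6 z * h (n - 6) z)"

definition op_add :: "hop \<Rightarrow> hop \<Rightarrow> hop" where
  "op_add a b = (\<lambda>h n z. a h n z + b h n z)"

definition op_smult :: "complex \<Rightarrow> hop \<Rightarrow> hop" where
  "op_smult c a = (\<lambda>h n z. c * a h n z)"

inductive_set Ralg :: "hop set" where
  R_id: "id \<in> Ralg"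
| R_delta: "delta \<in> Ralg"
| R_e4: "e4 \<in> Ralg"
| R_e6: "e6 \<in> Ralg"
| R_add: "a \<in> Ralg \<Longrightarrow> b \<in> Ralg \<Longrightarrow> op_add a b \<in> Ralg"
| R_smult: "a \<in> Ralg \<Longrightarrow> op_smult c a \<in> Ralg"
| R_comp: "a \<in> Ralg \<Longrightarrow> b \<in> Ralg \<Longrightarrow> a \<circ> b \<in> Ralg"

inductive inRk :: "real \<Rightarrow> hop \<Rightarrow> bool" where
  Rk_gen: "(k = 0 \<and> a = id) \<or> (k = 2 \<and> a = delta) \<or> (k = 4 \<and> a = e4)
           \<or> (k = 6 \<and> a = e6) \<Longrightarrow> inRk k a"
| Rk_add: "inRk k a \<Longrightarrow> inRk k b \<Longrightarrow> inRk k (op_add a b)"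
| Rk_smult: "inRk k a \<Longrightarrow> inRk k (op_smult c a)"
| Rk_comp: "inRk i a \<Longrightarrow> inRk j b \<Longrightarrow> k = i + j \<Longrightarrow> inRk k (a \<circ> b)"

text \<open>M = C[E4,E6] as the subalgebra of R generated by e4, e6.\<close>
inductive_set Mops :: "hop set" where
  M_id: "id \<in> Mops"
| M_e4: "e4 \<in> Mops"
| M_e6: "e6 \<in> Mops"
| M_add: "a \<in> Mops \<Longrightarrow> b \<in> Mops \<Longrightarrow> op_add a b \<in> Mops"
| M_smult: "a \<in> Mops \<Longrightarrow> op_smult c a \<in> Mops"
| M_comp: "a \<in> Mops \<Longrightarrow> b \<in> Mops \<Longrightarrow> a \<circ> b \<in> Mops"

text \<open>M_k: level-one modular forms of weight k, i.e. the weight-k polynomials in E4, E6.\<close>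
inductive inMk :: "real \<Rightarrow> (complex \<Rightarrow> complex) \<Rightarrow> bool" where
  Mk_gen: "(k = 0 \<and> f = (\<lambda>_. 1)) \<or> (k = 4 \<and> f = E4) \<or> (k = 6 \<and> f = E6) \<Longrightarrow> inMk k f"
| Mk_add: "inMk k f \<Longrightarrow> inMk k g \<Longrightarrow> inMk k (\<lambda>z. f z + g z)"
| Mk_smult: "inMk k f \<Longrightarrow> inMk k (\<lambda>z. c * f z)"
| Mk_mult: "inMk i f \<Longrightarrow> inMk j g \<Longrightarrow> k = i + j \<Longrightarrow> inMk k (\<lambda>z. f z * g z)"

definition Rk :: "real \<Rightarrow> hop set" where "Rk k = {a. inRk k a}"

definition Mk :: "real \<Rightarrow> (complex \<Rightarrow> complex) set" where "Mk k = {f. inMk k f}"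

definition monic :: "hop \<Rightarrow> bool" where
  "monic a \<longleftrightarrow> (\<exists>N m. (\<forall>i<N. m i \<in> Mops) \<and>
      a = (\<lambda>h n z. (delta ^^ N) h n z + (\<Sum>i<N. (m i \<circ> delta ^^ i) h n z)))"

text \<open>Zero in H (only values on the upper half plane are meaningful).\<close>
definition hzero :: "hel \<Rightarrow> bool" where
  "hzero h \<longleftrightarrow> (\<forall>n. \<forall>z\<in>uhp. h n z = 0)"

definition Sk :: "real \<Rightarrow> (complex \<Rightarrow> complex) set" where
  "Sk k = {f. f holomorphic_on uhp \<and> (\<exists>a. monic a \<and> hzero (a (hsingle k f)))}"

definition Ssum :: "hel set" where
  "Ssum = {h \<in> Hspace. \<forall>n. h n \<in> Sk n}"

end

(*
  A function killed by a monic operator generates, under delta, a finitely generated module over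
  M = C[E4, E6], and conversely: M is Noetherian, so if F lies in a finitely generated M-submodule
  of H stable under delta, the submodules spanned by F, delta F, ..., delta^n F stabilise, which
  gives a monic operator killing F.  Such submodules can be added and multiplied.

  Stability under delta needs M to be closed under the Serre derivative, i.e. Ramanujan's formulas
  for E4' and E6'.  They amount to identities between convolutions of divisor sums, which follow by
  summing the polynomials (x^2 - x y + y^2)^2, (x^2 - x y + y^2)^3 and x^2 y^2 (x - y)^2 over
  the solutions of a x + b y = n and using the bijection (a, b, x, y) -> (a, a + b, x - y, y)
  from the solutions with x > y to those with b > a.
*)
theory Submission
  imports Defs "HOL-Library.Function_Algebras" "HOL-Complex_Analysis.Cauchy_Integral_Formula"
begin

section \<open>Convolutions of divisor sums\<close>

text \<open>The polynomials are dictated by invariance: transposing and shearing match the terms of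
  P(a, b) with those of P(a, -b) as soon as P(u, v) = P(v, u) = P(u, u - v). These two involutions
  generate a dihedral group of order 12, whose polynomial invariants are generated by u^2 - u v +
  v^2 and u^2 v^2 (u - v)^2. Hence there is one polynomial in degree 4, for the convolution of
  sigma_1 and sigma_3 behind E4', and two in degree 6, for the pair sigma_1, sigma_5 and the pair
  sigma_3, sigma_3 behind E6'. Two obstacles shape the algebra. Identities hold only on the upper
  half plane, so equality becomes the relation \<open>heq\<close> and null elements join every span.
  Moreover \<open>Mops\<close> is a set of operators and not a ring type; scalars are therefore
  taken from the polynomial ring C[X][Y], acting through \<open>e4\<close> and \<open>e6\<close>,
  and the Noetherian property is applied to coordinate rows over that ring.\<close>

definition solutions :: "nat \<Rightarrow> (nat \<times> nat \<times> nat \<times> nat) set" where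
  "solutions n = {(a, b, x, y). 0 < a \<and> 0 < b \<and> 0 < x \<and> 0 < y \<and> a * x + b * y = n}"

lemma finite_solutions: "finite (solutions n)"
proof (rule finite_subset)
  show "solutions n \<subseteq> {..n} \<times> {..n} \<times> {..n} \<times> {..n}"
  proof
    fix t assume "t \<in> solutions n"
    then obtain a b x y where t: "t = (a, b, x, y)" "0 < a" "0 < b" "0 < x" "0 < y" "a * x + b * y = n"
      by (auto simp: solutions_def)
    have "a \<le> a * x" "x \<le> a * x" "b \<le> b * y" "y \<le> b * y"
      using t by simp_all
    with t(6) have "a \<le> n" "b \<le> n" "x \<le> n" "y \<le> n" by linarith+
    with t(1) show "t \<in> {..n} \<times> {..n} \<times> {..n} \<times> {..n}" by simp
  qed
qed simp

lemma sum_solutions_swap: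
  "(\<Sum>(a, b, x, y)\<in>{(a, b, x, y)\<in>solutions n. R a b x y}. f a b x y) =
   (\<Sum>(a, b, x, y)\<in>{(a, b, x, y)\<in>solutions n. R b a y x}. f b a y x)"
  by (rule sum.reindex_bij_witness[of _ "\<lambda>(a, b, x, y). (b, a, y, x)" "\<lambda>(a, b, x, y). (b, a, y, x)"])
     (auto simp: solutions_def add.commute)

lemma sum_solutions_transpose:
  "(\<Sum>(a, b, x, y)\<in>{(a, b, x, y)\<in>solutions n. R a b x y}. f a b x y) =
   (\<Sum>(a, b, x, y)\<in>{(a, b, x, y)\<in>solutions n. R x y a b}. f x y a b)"
  by (rule sum.reindex_bij_witness[of _ "\<lambda>(a, b, x, y). (x, y, a, b)" "\<lambda>(a, b, x, y). (x, y, a, b)"])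
     (auto simp: solutions_def mult.commute)

text \<open>The equation survives because a x + b y = a (x - y) + (a + b) y. A condition on x, y is
  traded for one on a, b, which a transposition turns back into a condition on x, y.\<close>

lemma sum_solutions_shear:
  "(\<Sum>(a, b, x, y)\<in>{(a, b, x, y)\<in>solutions n. x > y}. f a b x y) =
   (\<Sum>(a, b, x, y)\<in>{(a, b, x, y)\<in>solutions n. b > a}. f a (b - a) (x + y) y)"
  by (rule sum.reindex_bij_witness[of _ "\<lambda>(a, b, x, y). (a, b - a, x + y, y)"
        "\<lambda>(a, b, x, y). (a, a + b, x - y, y)"])
     (auto simp: solutions_def algebra_simps nat_le_iff_add elim!: less_natE)

lemma sum_solutions_symmetric:
  fixes f :: "nat \<Rightarrow> nat \<Rightarrow> nat \<Rightarrow> nat \<Rightarrow> complex"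
  assumes "\<And>a b x y. f b a y x = f a b x y"
  shows "(\<Sum>(a, b, x, y)\<in>solutions n. f a b x y) =
     2 * (\<Sum>(a, b, x, y)\<in>{(a, b, x, y)\<in>solutions n. x > y}. f a b x y)
     + (\<Sum>(a, b, x, y)\<in>{(a, b, x, y)\<in>solutions n. x = y}. f a b x y)"
proof -
  let ?S = "\<lambda>R. {(a, b, x, y)\<in>solutions n. R x y}"
  let ?s = "\<lambda>A. \<Sum>(a, b, x, y)\<in>A. f a b x y"
  have fin: "finite (?S R)" for R
    by (rule finite_subset[OF _ finite_solutions[of n]]) auto
  have "solutions n = (?S (>) \<union> ?S (<)) \<union> ?S (=)" by auto
  then have "?s (solutions n) = ?s ((?S (>) \<union> ?S (<)) \<union> ?S (=))" by simp
  also have "\<dots> = ?s (?S (>) \<union> ?S (<)) + ?s (?S (=))"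
    by (rule sum.union_disjoint) (use fin in auto)
  also have "?s (?S (>) \<union> ?S (<)) = ?s (?S (>)) + ?s (?S (<))"
    by (rule sum.union_disjoint) (use fin in auto)
  also have "?s (?S (<)) = ?s (?S (>))"
    by (subst sum_solutions_swap) (simp add: assms)
  finally show ?thesis by simp
qed

text \<open>With x = y the equation is (a + b) x = n: a diagonal solution is a divisor d = a + b of
  n together with a splitting of d into two positive parts.\<close>

lemma sum_solutions_diagonal:
  assumes "n > 0"
  shows "(\<Sum>(a, b, x, y)\<in>{(a, b, x, y)\<in>solutions n. x = y}. f a b x) =
    (\<Sum>d | d dvd n. \<Sum>b\<in>{1..<d}. f (d - b) b (n div d))"
proof -
  have fin: "finite {d. d dvd n}" using assms by simp
  have "(\<Sum>d | d dvd n. \<Sum>b\<in>{1..<d}. f (d - b) b (n div d)) =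
      (\<Sum>(d, b)\<in>(SIGMA d:{d. d dvd n}. {1..<d}). f (d - b) b (n div d))"
    using fin by (subst sum.Sigma) auto
  also have "\<dots> = (\<Sum>(a, b, x, y)\<in>{(a, b, x, y)\<in>solutions n. x = y}. f a b x)"
  proof (rule sum.reindex_bij_witness[of _ "\<lambda>(a, b, x, y). (a + b, b)" "\<lambda>(d, b). (d - b, b, n div d, n div d)"], goal_cases)
    case (1 t)
    then show ?case by auto
  next
    case (2 t)
    then obtain d b where t: "t = (d, b)" "d dvd n" "0 < b" "b < d" by auto
    from t(2) obtain k where k: "n = d * k" by blast
    with assms t have "k > 0" "n div d = k" by auto
    moreover have "(d - b) * k + b * k = n"
      using t k by (simp flip: add_mult_distrib)
    ultimately show ?case using t by (auto simp: solutions_def)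
  next
    case (3 t)
    then show ?case using assms by (auto simp: solutions_def simp flip: add_mult_distrib)
  next
    case (4 t)
    then show ?case by (auto simp: solutions_def simp flip: add_mult_distrib)
  next
    case (5 t)
    then show ?case by auto
  qed
  finally show ?thesis ..
qed

text \<open>Both sums are folded onto x > y. There transposition, shear and the symmetries of P
  carry the terms P(x, y) to P(a, -b), so the off-diagonal parts of the difference cancel and only
  the diagonal x = y remains.\<close>

theorem liouville_identity:
  fixes P :: "complex \<Rightarrow> complex \<Rightarrow> complex"
  assumes n: "n > 0"
    and sym: "\<And>u v. P u v = P v u"
    and shear: "\<And>u v. P u v = P u (u - v)"
  shows "(\<Sum>(a, b, x, y)\<in>solutions n. P (of_nat a) (of_nat b) - P (of_nat a) (- of_nat b)) =
    (\<Sum>d | d dvd n. (of_nat d - 1) * P (of_nat (n div d)) 0 - (\<Sum>b\<in>{1..<d}. P (of_nat d) (of_nat b)))"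
proof -
  \<comment> \<open>\<open>P u (- v)\<close> is symmetric in u and v as well, so its sum can be
    folded onto x > y too.\<close>
  have neg: "P v (- u) = P u (- v)" for u v
  proof -
    have "P v (- u) = P v (u + v)" using shear[of v "- u"] by (simp add: add.commute)
    also have "\<dots> = P (u + v) v" by (rule sym)
    also have "\<dots> = P (u + v) u" using shear[of "u + v" v] by simp
    also have "\<dots> = P u (u + v)" by (rule sym)
    also have "\<dots> = P u (- v)" using shear[of u "- v"] by simp
    finally show ?thesis .
  qed
  let ?G = "{(a, b, x, y)\<in>solutions n. x > y}" and ?E = "{(a, b, x, y)\<in>solutions n. x = y}"
  have "(\<Sum>(a, b, x, y)\<in>solutions n. P (of_nat a) (of_nat b)) =
      (\<Sum>(a, b, x, y)\<in>solutions n. P (of_nat x) (of_nat y))"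
    using sum_solutions_transpose[where R = "\<lambda>a b x y. True" and f = "\<lambda>a b x y. P (of_nat a) (of_nat b)"]
    by simp
  also have "\<dots> = 2 * (\<Sum>(a, b, x, y)\<in>?G. P (of_nat x) (of_nat y))
      + (\<Sum>(a, b, x, y)\<in>?E. P (of_nat x) (of_nat y))"
    by (rule sum_solutions_symmetric) (rule sym)
  also have "(\<Sum>(a, b, x, y)\<in>?G. P (of_nat x) (of_nat y)) =
      (\<Sum>(a, b, x, y)\<in>{(a, b, x, y)\<in>solutions n. b > a}. P (of_nat x) (- of_nat y))"
  proof (subst sum_solutions_shear[where f = "\<lambda>a b x y. P (of_nat x) (of_nat y)"], intro sum.cong refl)
    have "P (of_nat x + of_nat y) (of_nat y) = P (of_nat x) (- of_nat y)" for x y :: nat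
      by (metis add.commute add_diff_cancel_left' diff_minus_eq_add neg shear sym)
    then show "(case t of (a, b, x, y) \<Rightarrow> P (of_nat (x + y)) (of_nat y)) =
        (case t of (a, b, x, y) \<Rightarrow> P (of_nat x) (- of_nat y))" for t :: "nat \<times> nat \<times> nat \<times> nat"
      by (simp split: prod.split)
  qed
  also have "\<dots> = (\<Sum>(a, b, x, y)\<in>{(a, b, x, y)\<in>solutions n. y > x}. P (of_nat a) (- of_nat b))"
    by (rule sum_solutions_transpose)
  also have "\<dots> = (\<Sum>(a, b, x, y)\<in>?G. P (of_nat a) (- of_nat b))"
    by (subst sum_solutions_swap) (simp add: neg)
  finally have "(\<Sum>(a, b, x, y)\<in>solutions n. P (of_nat a) (of_nat b)) =
     2 * (\<Sum>(a, b, x, y)\<in>?G. P (of_nat a) (- of_nat b))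
      + (\<Sum>(a, b, x, y)\<in>?E. P (of_nat x) (of_nat y))" .
  moreover have "(\<Sum>(a, b, x, y)\<in>solutions n. P (of_nat a) (- of_nat b)) =
     2 * (\<Sum>(a, b, x, y)\<in>?G. P (of_nat a) (- of_nat b))
      + (\<Sum>(a, b, x, y)\<in>?E. P (of_nat a) (- of_nat b))"
    by (rule sum_solutions_symmetric) (rule neg)
  ultimately have "(\<Sum>(a, b, x, y)\<in>solutions n. P (of_nat a) (of_nat b) - P (of_nat a) (- of_nat b)) =
      (\<Sum>(a, b, x, y)\<in>?E. P (of_nat x) (of_nat y)) - (\<Sum>(a, b, x, y)\<in>?E. P (of_nat a) (- of_nat b))"
    by (simp add: case_prod_unfold sum_subtractf)
  also have "(\<Sum>(a, b, x, y)\<in>?E. P (of_nat x) (of_nat y)) = (\<Sum>(a, b, x, y)\<in>?E. P (of_nat x) 0)"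
    by (rule sum.cong) (auto simp: shear[of _ 0])
  also have "\<dots> = (\<Sum>d | d dvd n. \<Sum>b\<in>{1..<d}. P (of_nat (n div d)) 0)"
    by (rule sum_solutions_diagonal[OF n])
  also have "(\<Sum>(a, b, x, y)\<in>?E. P (of_nat a) (- of_nat b)) =
      (\<Sum>d | d dvd n. \<Sum>b\<in>{1..<d}. P (of_nat (d - b)) (- of_nat b))"
    by (rule sum_solutions_diagonal[OF n])
  also have "\<dots> = (\<Sum>d | d dvd n. \<Sum>b\<in>{1..<d}. P (of_nat d) (of_nat b))"
  proof (intro sum.cong refl)
    fix d b :: nat assume "b \<in> {1..<d}"
    then have "of_nat (d - b) = (of_nat d - of_nat b :: complex)" by (simp add: of_nat_diff)
    \<comment> \<open>P(d - b, -b) = P(d - b, d) = P(d, d - b) = P(d, b).\<close>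
    then show "P (of_nat (d - b)) (- of_nat b) = P (of_nat d) (of_nat b)"
      by (metis diff_add_cancel diff_minus_eq_add shear sym)
  qed
  also have "(\<Sum>d | d dvd n. \<Sum>b\<in>{1..<d}. P (of_nat (n div d)) 0) -
      (\<Sum>d | d dvd n. \<Sum>b\<in>{1..<d}. P (of_nat d) (of_nat b)) =
      (\<Sum>d | d dvd n. (of_nat d - 1) * P (of_nat (n div d)) 0 - (\<Sum>b\<in>{1..<d}. P (of_nat d) (of_nat b)))"
  proof (subst sum_subtractf[symmetric], intro sum.cong refl)
    fix d assume "d \<in> {d. d dvd n}"
    then have "d > 0" using n by (auto intro: Nat.gr0I)
    then show "(\<Sum>b\<in>{1..<d}. P (of_nat (n div d)) 0) - (\<Sum>b\<in>{1..<d}. P (of_nat d) (of_nat b)) =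
      (of_nat d - 1) * P (of_nat (n div d)) 0 - (\<Sum>b\<in>{1..<d}. P (of_nat d) (of_nat b))"
      by (simp add: of_nat_diff)
  qed
  finally show ?thesis .
qed

section \<open>Divisor sums as coefficients of formal power series\<close>

definition divisor_fps :: "nat \<Rightarrow> complex fps" where
  "divisor_fps j = Abs_fps (\<lambda>n. of_nat (dsigma j n))"

text \<open>Every natural number divides 0, so the defining sum runs over an infinite set and takes
  the default value 0. This makes the constant coefficient of \<open>divisor_fps j\<close>
  vanish.\<close>

lemma dsigma_0: "dsigma j 0 = 0"
  by (simp add: dsigma_def)

lemma of_nat_dsigma: "of_nat (dsigma j n) = (\<Sum>d | d dvd n. of_nat d ^ j)"
  by (simp add: dsigma_def)

text \<open>Grouping the solutions by m = a x lets a range over the divisors of m and b over those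
  of n - m. The end terms m = 0 and m = n of the Cauchy product vanish by
  \<open>dsigma_0\<close>.\<close>

lemma sum_solutions_monomial:
  "(\<Sum>(a, b, x, y)\<in>solutions n. of_nat a ^ i * of_nat b ^ j) = fps_nth (divisor_fps i * divisor_fps j) n"
proof -
  let ?D = "\<lambda>m. {d::nat. d dvd m}"
  let ?A = "SIGMA m:{1..<n}. ?D m \<times> ?D (n - m)"
  have "fps_nth (divisor_fps i * divisor_fps j) n = (\<Sum>m=0..n. of_nat (dsigma i m) * of_nat (dsigma j (n - m)))"
    by (simp add: fps_mult_nth divisor_fps_def)
  also have "\<dots> = (\<Sum>m\<in>{1..<n}. of_nat (dsigma i m) * of_nat (dsigma j (n - m)))"
  proof (rule sum.mono_neutral_right)
    show "\<forall>m\<in>{0..n} - {1..<n}. of_nat (dsigma i m) * of_nat (dsigma j (n - m)) = (0::complex)"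
    proof
      fix m assume "m \<in> {0..n} - {1..<n}"
      then have "m = 0 \<or> n - m = 0" by auto
      then show "of_nat (dsigma i m) * of_nat (dsigma j (n - m)) = (0::complex)"
        by (auto simp: dsigma_0)
    qed
  qed auto
  also have "\<dots> = (\<Sum>m\<in>{1..<n}. \<Sum>(a, b)\<in>?D m \<times> ?D (n - m). of_nat a ^ i * of_nat b ^ j)"
    by (simp add: of_nat_dsigma sum_product sum.cartesian_product)
  also have "\<dots> = (\<Sum>(m, a, b)\<in>?A. of_nat a ^ i * of_nat b ^ j)"
    by (subst sum.Sigma) auto
  also have "\<dots> = (\<Sum>(a, b, x, y)\<in>solutions n. of_nat a ^ i * of_nat b ^ j)"
  proof (rule sum.reindex_bij_witness[of _ "\<lambda>(a, b, x, y). (a * x, a, b)"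
        "\<lambda>(m, a, b). (a, b, m div a, (n - m) div b)"], goal_cases)
    case (1 t)
    then show ?case by auto
  next
    case (2 t)
    then obtain m a b where t: "t = (m, a, b)" "0 < m" "m < n" "a dvd m" "b dvd n - m" by auto
    then obtain x y where xy: "m = a * x" "n - m = b * y" by blast
    then have "a > 0" "x > 0" "b > 0" "y > 0" using t by (auto intro: Nat.gr0I)
    with t xy show ?case by (auto simp: solutions_def)
  next
    case (3 t)
    then show ?case by (auto simp: solutions_def)
  next
    case (4 t)
    then show ?case by (auto simp: solutions_def)
  next
    case (5 t)
    then show ?case by auto
  qed
  finally show ?thesis ..
qed

lemma sum_divisors_complement:
  fixes n :: nat
  assumes "n > 0"
  shows "(\<Sum>d | d dvd n. f (n div d) d) = (\<Sum>d | d dvd n. f d (n div d))"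
proof (rule sum.reindex_bij_witness[of _ "\<lambda>d. n div d" "\<lambda>d. n div d"])
  fix d assume "d \<in> {d. d dvd n}"
  then obtain k where "n = d * k" by blast
  with assms have "n = d * k" "d > 0" "k > 0" by (simp_all add: nat_0_less_mult_iff)
  then show "n div (n div d) = d" "n div d \<in> {d. d dvd n}" "f (n div d) (n div (n div d)) = f (n div d) d"
    by auto
qed (use assms in \<open>auto elim!: dvdE\<close>)

text \<open>Passing to complementary divisors turns the summand into (n div d - 1) d^(j+1) = n d^j -
  d^(j+1).\<close>

lemma sum_divisors_boundary:
  assumes "n > 0"
  shows "(\<Sum>d | d dvd n. (of_nat d - 1) * of_nat (n div d) ^ Suc j) =
    of_nat n * of_nat (dsigma j n) - (of_nat (dsigma (Suc j) n) :: complex)"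
proof -
  have "(\<Sum>d | d dvd n. (of_nat d - 1) * of_nat (n div d) ^ Suc j) =
      (\<Sum>d | d dvd n. (of_nat (n div d) - 1) * (of_nat d :: complex) ^ Suc j)"
    by (rule sum_divisors_complement[OF assms, symmetric])
  also have "\<dots> = (\<Sum>d | d dvd n. of_nat n * of_nat d ^ j - of_nat d ^ Suc j)"
  proof (intro sum.cong refl)
    fix d assume "d \<in> {d. d dvd n}"
    then have "of_nat n = (of_nat d * of_nat (n div d) :: complex)"
      by (simp flip: of_nat_mult)
    then show "(of_nat (n div d) - 1) * (of_nat d :: complex) ^ Suc j =
        of_nat n * of_nat d ^ j - of_nat d ^ Suc j"
      by (simp add: algebra_simps)
  qed
  finally show ?thesis
    by (simp add: of_nat_dsigma sum_subtractf sum_distrib_left)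
qed

section \<open>Power sums of the invariant polynomials and the convolution identities\<close>

lemma sum_quartic:
  assumes "d > 0"
  shows "30 * (\<Sum>b\<in>{1..<d}. (of_nat d ^ 2 - of_nat d * of_nat b + of_nat b ^ 2) ^ 2) =
      (21 * of_nat d ^ 5 - 30 * of_nat d ^ 4 + 10 * of_nat d ^ 3 - of_nat d :: complex)"
proof -
  \<comment> \<open>The bound n is decoupled from u, since the induction on n needs u fixed;
    afterwards both become d. The coefficients come from Faulhaber's formulas, whose denominators 30
    clears. The term b = 0, equal to d^4, is then split off.\<close>
  have *: "30 * (\<Sum>b<n. (u ^ 2 - u * of_nat b + of_nat b ^ 2) ^ 2) =
      30 * u ^ 4 * of_nat n - 30 * u ^ 3 * of_nat n ^ 2 + 30 * u ^ 3 * of_nat n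
      + 30 * u ^ 2 * of_nat n ^ 3 - 45 * u ^ 2 * of_nat n ^ 2 + 15 * u ^ 2 * of_nat n
      - 15 * u * of_nat n ^ 4 + 30 * u * of_nat n ^ 3 - 15 * u * of_nat n ^ 2 + 6 * of_nat n ^ 5
      - 15 * of_nat n ^ 4 + 10 * of_nat n ^ 3 - of_nat n"
    for u :: complex and n
    by (induction n) (simp_all add: algebra_simps power_numeral_reduce)
  have "{..<d} = insert 0 {1..<d}" using assms by auto
  then have "(\<Sum>b<d. (of_nat d ^ 2 - of_nat d * of_nat b + of_nat b ^ 2) ^ 2) =
      (\<Sum>b\<in>{1..<d}. (of_nat d ^ 2 - of_nat d * of_nat b + of_nat b ^ 2) ^ 2)
      + (of_nat d ^ 4 :: complex)"
    by (simp add: power_mult_distrib flip: power_mult)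
  with *[of "of_nat d" d] show ?thesis
    by (simp add: algebra_simps power_numeral_reduce)
qed

lemma sum_sextic:
  assumes "d > 0"
  shows "420 * (\<Sum>b\<in>{1..<d}. (of_nat d ^ 2 - of_nat d * of_nat b + of_nat b ^ 2) ^ 3) =
      (249 * of_nat d ^ 7 - 420 * of_nat d ^ 6 + 210 * of_nat d ^ 5 - 49 * of_nat d ^ 3
      + 10 * of_nat d :: complex)"
proof -
  have *: "420 * (\<Sum>b<n. (u ^ 2 - u * of_nat b + of_nat b ^ 2) ^ 3) =
      420 * u ^ 6 * of_nat n - 630 * u ^ 5 * of_nat n ^ 2 + 630 * u ^ 5 * of_nat n
      + 840 * u ^ 4 * of_nat n ^ 3 - 1260 * u ^ 4 * of_nat n ^ 2 + 420 * u ^ 4 * of_nat n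
      - 735 * u ^ 3 * of_nat n ^ 4 + 1470 * u ^ 3 * of_nat n ^ 3 - 735 * u ^ 3 * of_nat n ^ 2
      + 504 * u ^ 2 * of_nat n ^ 5 - 1260 * u ^ 2 * of_nat n ^ 4 + 840 * u ^ 2 * of_nat n ^ 3
      - 84 * u ^ 2 * of_nat n - 210 * u * of_nat n ^ 6 + 630 * u * of_nat n ^ 5
      - 525 * u * of_nat n ^ 4 + 105 * u * of_nat n ^ 2 + 60 * of_nat n ^ 7 - 210 * of_nat n ^ 6
      + 210 * of_nat n ^ 5 - 70 * of_nat n ^ 3 + 10 * of_nat n"
    for u :: complex and n
    by (induction n) (simp_all add: algebra_simps power_numeral_reduce)
  have "{..<d} = insert 0 {1..<d}" using assms by auto
  then have "(\<Sum>b<d. (of_nat d ^ 2 - of_nat d * of_nat b + of_nat b ^ 2) ^ 3) =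
      (\<Sum>b\<in>{1..<d}. (of_nat d ^ 2 - of_nat d * of_nat b + of_nat b ^ 2) ^ 3)
      + (of_nat d ^ 6 :: complex)"
    by (simp add: power_mult_distrib flip: power_mult)
  with *[of "of_nat d" d] show ?thesis
    by (simp add: algebra_simps power_numeral_reduce)
qed

lemma sum_sextic_split:
  assumes "d > 0"
  shows "60 * (\<Sum>b\<in>{1..<d}. of_nat d ^ 2 * of_nat b ^ 2 * (of_nat d - of_nat b) ^ 2) =
      (2 * of_nat d ^ 7 - 2 * of_nat d ^ 3 :: complex)"
proof -
  have *: "60 * (\<Sum>b<n. u ^ 2 * of_nat b ^ 2 * (u - of_nat b) ^ 2) =
      20 * u ^ 4 * of_nat n ^ 3 - 30 * u ^ 4 * of_nat n ^ 2 + 10 * u ^ 4 * of_nat n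
      - 30 * u ^ 3 * of_nat n ^ 4 + 60 * u ^ 3 * of_nat n ^ 3 - 30 * u ^ 3 * of_nat n ^ 2
      + 12 * u ^ 2 * of_nat n ^ 5 - 30 * u ^ 2 * of_nat n ^ 4 + 20 * u ^ 2 * of_nat n ^ 3
      - 2 * u ^ 2 * of_nat n"
    for u :: complex and n
    by (induction n) (simp_all add: algebra_simps power_numeral_reduce)
  have "{..<d} = insert 0 {1..<d}" using assms by auto
  then have "(\<Sum>b<d. of_nat d ^ 2 * of_nat b ^ 2 * (of_nat d - of_nat b) ^ 2) =
      (\<Sum>b\<in>{1..<d}. of_nat d ^ 2 * of_nat b ^ 2 * (of_nat d - of_nat b) ^ 2) + (0 :: complex)"
    by (simp add: power_mult_distrib flip: power_mult)
  with *[of "of_nat d" d] show ?thesis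
    by (simp add: algebra_simps power_numeral_reduce)
qed

text \<open>\<open>N\<close> clears the denominators of the power sums, and \<open>c\<close> is the
  coefficient of u^(j+1) in P(u, v), the only monomial that survives at v = 0.\<close>

lemma liouville_identity_power_sums:
  fixes P :: "complex \<Rightarrow> complex \<Rightarrow> complex"
  assumes n: "n > 0"
    and "\<And>u v. P u v = P v u" "\<And>u v. P u v = P u (u - v)"
    and P0: "\<And>u. P u 0 = c * u ^ Suc j"
    and s: "\<And>d. d > 0 \<Longrightarrow> N * (\<Sum>b\<in>{1..<d}. P (of_nat d) (of_nat b)) = g d"
  shows "N * (\<Sum>(a, b, x, y)\<in>solutions n. P (of_nat a) (of_nat b) - P (of_nat a) (- of_nat b)) =
    N * c * (of_nat n * of_nat (dsigma j n) - of_nat (dsigma (Suc j) n)) - (\<Sum>d | d dvd n. g d)"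
proof -
  have d0: "d > 0" if "d dvd n" for d using that n by (auto intro: Nat.gr0I)
  have "N * (\<Sum>(a, b, x, y)\<in>solutions n. P (of_nat a) (of_nat b) - P (of_nat a) (- of_nat b)) =
     (\<Sum>d | d dvd n. N * ((of_nat d - 1) * P (of_nat (n div d)) 0 - (\<Sum>b\<in>{1..<d}. P (of_nat d) (of_nat b))))"
    by (subst liouville_identity[OF assms(1-3)]) (simp_all add: sum_distrib_left)
  also have "\<dots> = (\<Sum>d | d dvd n. N * c * ((of_nat d - 1) * of_nat (n div d) ^ Suc j) - g d)"
    by (intro sum.cong refl) (simp add: right_diff_distrib s d0 P0 del: One_nat_def)
  finally show ?thesis
    unfolding sum_subtractf sum_distrib_left[symmetric] sum_divisors_boundary[OF n] .
qed

text \<open>The difference doubles the part of P odd in v, giving -4 (u^3 v + u v^3); both monomials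
  yield the same convolution. The sigma_4 of the boundary term cancels against the one from the
  power sum.\<close>

lemma convolution_1_3:
  assumes "n > 0"
  shows "240 * fps_nth (divisor_fps 1 * divisor_fps 3) n =
    21 * of_nat (dsigma 5 n) + 10 * of_nat (dsigma 3 n) - of_nat (dsigma 1 n) - 30 * of_nat n * of_nat (dsigma 3 n)"
proof -
  let ?P = "\<lambda>u v :: complex. (u ^ 2 - u * v + v ^ 2) ^ 2"
  let ?T = "\<Sum>(a, b, x, y)\<in>solutions n. ?P (of_nat a) (of_nat b) - ?P (of_nat a) (- of_nat b)"
  have "?T = (\<Sum>(a, b, x, y)\<in>solutions n. - 4 * (of_nat a ^ 1 * of_nat b ^ 3)) +
      (\<Sum>(a, b, x, y)\<in>solutions n. - 4 * (of_nat a ^ 3 * of_nat b ^ 1))"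
    unfolding sum.distrib[symmetric]
    by (rule sum.cong) (auto simp: algebra_simps power_numeral_reduce)
  also have "\<dots> = - 8 * fps_nth (divisor_fps 1 * divisor_fps 3) n"
    unfolding case_prod_unfold sum_distrib_left[symmetric]
    unfolding sum_solutions_monomial[unfolded case_prod_unfold]
    by (simp add: mult.commute)
  finally have lhs: "?T = - 8 * fps_nth (divisor_fps 1 * divisor_fps 3) n" .
  have "30 * ?T = 30 * 1 * (of_nat n * of_nat (dsigma 3 n) - of_nat (dsigma (Suc 3) n)) -
      (\<Sum>d | d dvd n. 21 * of_nat d ^ 5 - 30 * of_nat d ^ 4 + 10 * of_nat d ^ 3 - of_nat d)"
  proof (rule liouville_identity_power_sums[OF assms], goal_cases)
    case (4 d)
    then show ?case by (rule sum_quartic)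
  qed (simp_all add: algebra_simps power_numeral_reduce)
  then show ?thesis
    unfolding lhs by (simp add: sum_subtractf sum.distrib of_nat_dsigma algebra_simps flip: sum_distrib_left)
qed

text \<open>This is the coefficient form of E4^2 = E8. The part of the polynomial odd in v is the
  single monomial -2 u^3 v^3.\<close>

lemma convolution_3_3:
  assumes "n > 0"
  shows "120 * fps_nth (divisor_fps 3 * divisor_fps 3) n = of_nat (dsigma 7 n) - of_nat (dsigma 3 n)"
proof -
  let ?P = "\<lambda>u v :: complex. u ^ 2 * v ^ 2 * (u - v) ^ 2"
  let ?T = "\<Sum>(a, b, x, y)\<in>solutions n. ?P (of_nat a) (of_nat b) - ?P (of_nat a) (- of_nat b)"
  have "?T = (\<Sum>(a, b, x, y)\<in>solutions n. - 4 * (of_nat a ^ 3 * of_nat b ^ 3))"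
    by (rule sum.cong) (auto simp: algebra_simps power_numeral_reduce)
  also have "\<dots> = - 4 * fps_nth (divisor_fps 3 * divisor_fps 3) n"
    unfolding case_prod_unfold sum_distrib_left[symmetric]
    unfolding sum_solutions_monomial[unfolded case_prod_unfold] ..
  finally have lhs: "?T = - 4 * fps_nth (divisor_fps 3 * divisor_fps 3) n" .
  \<comment> \<open>Here P(u, 0) = 0, so \<open>c\<close> is 0 and the index 3 in the boundary term
    is only a placeholder.\<close>
  have "60 * ?T = 60 * 0 * (of_nat n * of_nat (dsigma 3 n) - of_nat (dsigma (Suc 3) n)) -
      (\<Sum>d | d dvd n. 2 * of_nat d ^ 7 - 2 * of_nat d ^ 3)"
  proof (rule liouville_identity_power_sums[OF assms], goal_cases)
    case (4 d)
    then show ?case by (rule sum_sextic_split)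
  qed (simp_all add: algebra_simps power_numeral_reduce)
  then have "2 * (120 * fps_nth (divisor_fps 3 * divisor_fps 3) n) = 2 * (of_nat (dsigma 7 n) - of_nat (dsigma 3 n))"
    unfolding lhs by (simp add: sum_subtractf sum.distrib of_nat_dsigma algebra_simps flip: sum_distrib_left)
  then show ?thesis by (simp only: mult_cancel_left) simp
qed

text \<open>The odd part of the cube contains u v^5, u^5 v and also u^3 v^3, so two convolutions
  appear together; \<open>convolution_3_3\<close> is what separates them. The sigma_6 terms
  cancel.\<close>

lemma convolution_1_5:
  assumes "n > 0"
  shows "5040 * fps_nth (divisor_fps 1 * divisor_fps 5) n + 5880 * fps_nth (divisor_fps 3 * divisor_fps 3) n =
    249 * of_nat (dsigma 7 n) + 210 * of_nat (dsigma 5 n) - 49 * of_nat (dsigma 3 n) + 10 * of_nat (dsigma 1 n)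
    - 420 * of_nat n * of_nat (dsigma 5 n)"
proof -
  let ?P = "\<lambda>u v :: complex. (u ^ 2 - u * v + v ^ 2) ^ 3"
  let ?T = "\<Sum>(a, b, x, y)\<in>solutions n. ?P (of_nat a) (of_nat b) - ?P (of_nat a) (- of_nat b)"
  have "?T = (\<Sum>(a, b, x, y)\<in>solutions n. - 6 * (of_nat a ^ 1 * of_nat b ^ 5)) +
      (\<Sum>(a, b, x, y)\<in>solutions n. - 6 * (of_nat a ^ 5 * of_nat b ^ 1)) +
      (\<Sum>(a, b, x, y)\<in>solutions n. - 14 * (of_nat a ^ 3 * of_nat b ^ 3))"
    unfolding sum.distrib[symmetric]
    by (rule sum.cong) (auto simp: algebra_simps power_numeral_reduce)
  also have "\<dots> = - 12 * fps_nth (divisor_fps 1 * divisor_fps 5) n - 14 * fps_nth (divisor_fps 3 * divisor_fps 3) n"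
    unfolding case_prod_unfold sum_distrib_left[symmetric]
    unfolding sum_solutions_monomial[unfolded case_prod_unfold]
    by (simp add: mult.commute)
  finally have lhs: "?T = - 12 * fps_nth (divisor_fps 1 * divisor_fps 5) n - 14 * fps_nth (divisor_fps 3 * divisor_fps 3) n" .
  have "420 * ?T = 420 * 1 * (of_nat n * of_nat (dsigma 5 n) - of_nat (dsigma (Suc 5) n)) -
      (\<Sum>d | d dvd n. 249 * of_nat d ^ 7 - 420 * of_nat d ^ 6 + 210 * of_nat d ^ 5 - 49 * of_nat d ^ 3 + 10 * of_nat d)"
  proof (rule liouville_identity_power_sums[OF assms], goal_cases)
    case (4 d)
    then show ?case by (rule sum_sextic)
  qed (simp_all add: algebra_simps power_numeral_reduce)
  moreover have "(\<Sum>d | d dvd n. 249 * of_nat d ^ 7 - 420 * of_nat d ^ 6 + 210 * of_nat d ^ 5 - 49 * of_nat d ^ 3 + 10 * of_nat d) =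
      249 * of_nat (dsigma 7 n) - 420 * of_nat (dsigma 6 n) + 210 * of_nat (dsigma 5 n)
      - 49 * of_nat (dsigma 3 n) + (10 * of_nat (dsigma 1 n) :: complex)"
    by (simp add: sum_subtractf sum.distrib of_nat_dsigma sum_distrib_left)
  ultimately show ?thesis
    unfolding lhs by (simp add: algebra_simps)
qed

section \<open>Ramanujan's formulas for formal power series in q\<close>

definition E2_fps :: "complex fps" where "E2_fps = 1 - fps_const 24 * divisor_fps 1"
definition E4_fps :: "complex fps" where "E4_fps = 1 + fps_const 240 * divisor_fps 3"
definition E6_fps :: "complex fps" where "E6_fps = 1 - fps_const 504 * divisor_fps 5"

lemma divisor_fps_nth: "fps_nth (divisor_fps j) n = of_nat (dsigma j n)"
  by (simp add: divisor_fps_def)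

lemma fps_X_deriv_nth: "fps_nth (fps_X * fps_deriv f) n = of_nat n * fps_nth (f :: complex fps) n"
  by (cases n) simp_all

text \<open>\<open>fps_X * fps_deriv\<close> is q d/dq. The product of the series brings in 5760 =
  24 * 240 times the convolution, so \<open>convolution_1_3\<close> enters 24 times; its term 30 n
  sigma_3 then becomes 720 n sigma_3, which is three times the coefficient of q d/dq E4.\<close>

lemma ramanujan_fps_E4: "fps_const 3 * (fps_X * fps_deriv E4_fps) = E2_fps * E4_fps - E6_fps"
proof (rule fps_ext)
  fix n
  let ?c = "fps_nth (divisor_fps 1 * divisor_fps 3) n"
  have "E2_fps * E4_fps - E6_fps = fps_const 504 * divisor_fps 5 + fps_const 240 * divisor_fps 3
      - fps_const 24 * divisor_fps 1 - fps_const 5760 * (divisor_fps 1 * divisor_fps 3)"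
    unfolding E2_fps_def E4_fps_def E6_fps_def by (simp add: algebra_simps flip: numeral_fps_const)
  then have *: "fps_nth (E2_fps * E4_fps - E6_fps) n = 504 * of_nat (dsigma 5 n) + 240 * of_nat (dsigma 3 n)
      - 24 * of_nat (dsigma 1 n) - 5760 * ?c"
    by (simp add: divisor_fps_nth)
  have "5760 * ?c = 24 * (240 * ?c)" by simp
  show "fps_nth (fps_const 3 * (fps_X * fps_deriv E4_fps)) n = fps_nth (E2_fps * E4_fps - E6_fps) n"
  proof (cases "n = 0")
    case True
    then show ?thesis unfolding * by (simp add: dsigma_0 divisor_fps_nth)
  next
    case False
    then show ?thesis
      unfolding * \<open>5760 * ?c = 24 * (240 * ?c)\<close> convolution_1_3[OF False[unfolded neq0_conv]]
      by (simp add: fps_X_deriv_nth E4_fps_def divisor_fps_nth algebra_simps)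
  qed
qed

lemma ramanujan_fps_E6: "fps_const 2 * (fps_X * fps_deriv E6_fps) = E2_fps * E6_fps - E4_fps * E4_fps"
proof (rule fps_ext)
  fix n
  let ?c = "fps_nth (divisor_fps 1 * divisor_fps 5) n" and ?d = "fps_nth (divisor_fps 3 * divisor_fps 3) n"
  have "E2_fps * E6_fps - E4_fps * E4_fps = fps_const 12096 * (divisor_fps 1 * divisor_fps 5)
      - fps_const 57600 * (divisor_fps 3 * divisor_fps 3)
      - fps_const 504 * divisor_fps 5 - fps_const 480 * divisor_fps 3 - fps_const 24 * divisor_fps 1"
    unfolding E2_fps_def E4_fps_def E6_fps_def by (simp add: algebra_simps flip: numeral_fps_const)
  then have *: "fps_nth (E2_fps * E6_fps - E4_fps * E4_fps) n = (12096 * ?c - 57600 * ?d)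
     - 504 * of_nat (dsigma 5 n) - 480 * of_nat (dsigma 3 n) - 24 * of_nat (dsigma 1 n)"
    by (simp add: divisor_fps_nth)
  show "fps_nth (fps_const 2 * (fps_X * fps_deriv E6_fps)) n = fps_nth (E2_fps * E6_fps - E4_fps * E4_fps) n"
  proof (cases "n = 0")
    case True
    then show ?thesis unfolding * by (simp add: dsigma_0 divisor_fps_nth)
  next
    case False
    \<comment> \<open>The multipliers eliminate sigma_7, as 12 * 249 = 2988, and the factor 5 keeps
      them integral, as 12 * 5040 = 5 * 12096.\<close>
    have "5 * (12096 * ?c - 57600 * ?d) = 12 * (5040 * ?c + 5880 * ?d) - 2988 * (120 * ?d)"
      by simp
    also have "\<dots> = 5 * (480 * of_nat (dsigma 3 n) + 504 * of_nat (dsigma 5 n) + 24 * of_nat (dsigma 1 n)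
        - 1008 * of_nat n * of_nat (dsigma 5 n))"
      unfolding convolution_1_5[OF False[unfolded neq0_conv]] convolution_3_3[OF False[unfolded neq0_conv]]
      by (simp add: algebra_simps)
    finally have "12096 * ?c - 57600 * ?d = 480 * of_nat (dsigma 3 n) + 504 * of_nat (dsigma 5 n) + 24 * of_nat (dsigma 1 n)
        - 1008 * of_nat n * of_nat (dsigma 5 n)"
      by (simp only: mult_cancel_left) simp
    then show ?thesis
      unfolding * using False by (simp add: fps_X_deriv_nth E6_fps_def divisor_fps_nth algebra_simps)
  qed
qed

section \<open>Ramanujan's differential equations\<close>

text \<open>There are at most n divisors, each at most n. Polynomial growth of the coefficients
  gives radius of convergence at least 1.\<close>

lemma dsigma_le: "dsigma j n \<le> n ^ Suc j"
proof (cases "n = 0")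
  case False
  have "dsigma j n \<le> of_nat (card {d. d dvd n}) * n ^ j"
    unfolding dsigma_def
    by (rule sum_bounded_above) (use False in \<open>auto intro!: power_mono intro: dvd_imp_le\<close>)
  then have "dsigma j n \<le> card {d. d dvd n} * n ^ j" by simp
  also have "card {d. d dvd n} \<le> card {1..n}"
    using False by (intro card_mono) (auto intro: dvd_imp_le Nat.gr0I)
  finally show ?thesis by simp
qed (simp add: dsigma_0)

lemma conv_radius_power: "conv_radius (\<lambda>n. of_nat n ^ j :: complex) = 1"
proof (rule conv_radius_ratio_limit_nonzero)
  have "(\<lambda>n. (of_nat n / of_nat (Suc n)) ^ j :: real) \<longlonglongrightarrow> 1 ^ j"
    by (intro tendsto_power LIMSEQ_n_over_Suc_n)
  then show "(\<lambda>n. norm (of_nat n ^ j :: complex) / norm (of_nat (Suc n) ^ j :: complex)) \<longlonglongrightarrow> 1"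
    by (simp add: norm_power power_divide del: of_nat_Suc)
qed auto

lemma divisor_fps_radius: "fps_conv_radius (divisor_fps j) \<ge> 1"
  unfolding fps_conv_radius_def
proof (rule conv_radius_geI_ex')
  fix r :: real assume r: "0 < r" "ereal r < 1"
  have "summable (\<lambda>n. norm (of_nat n ^ Suc j * of_real r ^ n :: complex))"
    by (rule abs_summable_in_conv_radius) (use r in \<open>simp add: conv_radius_power del: power_Suc\<close>)
  then show "summable (\<lambda>n. fps_nth (divisor_fps j) n * of_real r ^ n)"
  proof (rule summable_comparison_test')
    fix n :: nat assume "n \<ge> 0"
    have "real (dsigma j n) \<le> real n ^ Suc j"
      using dsigma_le[of j n] of_nat_mono by fastforce
    then show "norm (fps_nth (divisor_fps j) n * of_real r ^ n) \<le> norm (of_nat n ^ Suc j * of_real r ^ n :: complex)"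
      using r by (simp add: divisor_fps_nth norm_mult norm_power mult_right_mono del: power_Suc)
  qed
qed

lemma norm_qpar: "z \<in> uhp \<Longrightarrow> norm (qpar z) < 1"
  by (simp add: qpar_def uhp_def)

lemma norm_qpar_less_radius:
  assumes "z \<in> uhp" "fps_conv_radius f \<ge> 1"
  shows "ereal (norm (qpar z)) < fps_conv_radius f"
  using norm_qpar[OF assms(1)] assms(2) by (metis ereal_less(3) order_less_le_trans)

lemma eval_divisor_fps:
  assumes "z \<in> uhp"
  shows "eval_fps (divisor_fps j) (qpar z) = (\<Sum>n. of_nat (dsigma j (Suc n)) * qpar z ^ Suc n)"
  using suminf_split_head[OF summable_fps[OF norm_qpar_less_radius[OF assms divisor_fps_radius[of j]]]]
  by (simp add: eval_fps_def divisor_fps_nth dsigma_0)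

lemma fps_conv_radius_add_const_mult_divisor_fps:
  "fps_conv_radius (1 + fps_const c * divisor_fps j) \<ge> 1" "fps_conv_radius (1 - fps_const c * divisor_fps j) \<ge> 1"
proof -
  have "fps_conv_radius (fps_const c * divisor_fps j) \<ge> 1"
    using fps_conv_radius_mult[of "fps_const c" "divisor_fps j"] divisor_fps_radius[of j]
    by (simp add: min_def split: if_splits)
  then show "fps_conv_radius (1 + fps_const c * divisor_fps j) \<ge> 1" "fps_conv_radius (1 - fps_const c * divisor_fps j) \<ge> 1"
    using fps_conv_radius_add[of 1 "fps_const c * divisor_fps j"] fps_conv_radius_diff[of 1 "fps_const c * divisor_fps j"]
    by (auto simp: min_def split: if_splits)
qed

lemma Eisenstein_fps_radius:
  "fps_conv_radius E2_fps \<ge> 1" "fps_conv_radius E4_fps \<ge> 1" "fps_conv_radius E6_fps \<ge> 1"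
  unfolding E2_fps_def E4_fps_def E6_fps_def by (rule fps_conv_radius_add_const_mult_divisor_fps)+

lemma eval_add_const_mult_divisor_fps:
  assumes "z \<in> uhp"
  shows "eval_fps (1 + fps_const c * divisor_fps j) (qpar z) = 1 + c * (\<Sum>n. of_nat (dsigma j (Suc n)) * qpar z ^ Suc n)"
    "eval_fps (1 - fps_const c * divisor_fps j) (qpar z) = 1 - c * (\<Sum>n. of_nat (dsigma j (Suc n)) * qpar z ^ Suc n)"
proof -
  note r = norm_qpar_less_radius[OF assms divisor_fps_radius[of j]]
  have r': "fps_conv_radius (fps_const c * divisor_fps j) \<ge> 1"
    using fps_conv_radius_mult[of "fps_const c" "divisor_fps j"] divisor_fps_radius[of j]
    by (simp add: min_def split: if_splits)
  show "eval_fps (1 + fps_const c * divisor_fps j) (qpar z) = 1 + c * (\<Sum>n. of_nat (dsigma j (Suc n)) * qpar z ^ Suc n)"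
    "eval_fps (1 - fps_const c * divisor_fps j) (qpar z) = 1 - c * (\<Sum>n. of_nat (dsigma j (Suc n)) * qpar z ^ Suc n)"
    using norm_qpar_less_radius[OF assms r'] r
    by (simp_all add: eval_fps_add eval_fps_diff eval_fps_mult eval_divisor_fps[OF assms])
qed

lemma Eisenstein_eq_eval_fps:
  assumes "z \<in> uhp"
  shows "E2 z = eval_fps E2_fps (qpar z)" "E4 z = eval_fps E4_fps (qpar z)" "E6 z = eval_fps E6_fps (qpar z)"
  unfolding E2_def E4_def E6_def E2_fps_def E4_fps_def E6_fps_def
  using assms by (simp_all only: eval_add_const_mult_divisor_fps)

lemma open_uhp: "open uhp"
  unfolding uhp_def by (rule open_halfspace_Im_gt)

text \<open>Since q' = 2 pi i q, the chain rule turns d/dz into 2 pi i times q d/dq. Agreement of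
  \<open>g\<close> with the series on \<open>uhp\<close> determines the derivative because
  \<open>uhp\<close> is open.\<close>

lemma has_field_derivative_eval_fps_qpar:
  assumes f: "fps_conv_radius f \<ge> 1" and eq: "\<And>z. z \<in> uhp \<Longrightarrow> g z = eval_fps f (qpar z)" and z: "z \<in> uhp"
  shows "(g has_field_derivative 2 * of_real pi * \<i> * eval_fps (fps_X * fps_deriv f) (qpar z)) (at z)"
proof -
  have r: "ereal (norm (qpar z)) < fps_conv_radius (fps_deriv f)"
    using norm_qpar_less_radius[OF z] f fps_conv_radius_deriv[of f] order_trans by blast
  have "(qpar has_field_derivative 2 * of_real pi * \<i> * qpar z) (at z)"
    unfolding qpar_def by (auto intro!: derivative_eq_intros)
  then have "((\<lambda>z. eval_fps f (qpar z)) has_field_derivative eval_fps (fps_deriv f) (qpar z) * (2 * of_real pi * \<i> * qpar z)) (at z)"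
    by (rule DERIV_chain2[where f = "eval_fps f" and g = qpar, OF has_field_derivative_eval_fps[OF norm_qpar_less_radius[OF z f]]])
  then have "(g has_field_derivative eval_fps (fps_deriv f) (qpar z) * (2 * of_real pi * \<i> * qpar z)) (at z)"
    by (rule has_field_derivative_transform_within_open[OF _ open_uhp z]) (simp add: eq)
  then show ?thesis
    using r by (simp add: eval_fps_mult mult_ac)
qed

lemma qderiv_eq_eval_fps:
  assumes "fps_conv_radius f \<ge> 1" "\<And>z. z \<in> uhp \<Longrightarrow> g z = eval_fps f (qpar z)" "z \<in> uhp"
  shows "qderiv g z = eval_fps (fps_X * fps_deriv f) (qpar z)"
  using DERIV_imp_deriv[OF has_field_derivative_eval_fps_qpar[OF assms]] by (simp add: qderiv_def)

lemma holomorphic_eval_fps_qpar: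
  assumes "fps_conv_radius f \<ge> 1" "\<And>z. z \<in> uhp \<Longrightarrow> g z = eval_fps f (qpar z)"
  shows "g holomorphic_on uhp"
  unfolding holomorphic_on_open[OF open_uhp]
  using has_field_derivative_eval_fps_qpar[OF assms] by blast

lemma holomorphic_Eisenstein: "E2 holomorphic_on uhp" "E4 holomorphic_on uhp" "E6 holomorphic_on uhp"
  by (rule holomorphic_eval_fps_qpar, rule Eisenstein_fps_radius, erule Eisenstein_eq_eval_fps)+

lemma fps_X_deriv_radius: "fps_conv_radius f \<ge> 1 \<Longrightarrow> fps_conv_radius (fps_X * fps_deriv (f :: complex fps)) \<ge> 1"
  using fps_conv_radius_mult[of fps_X "fps_deriv f"] fps_conv_radius_deriv[of f]
  by (auto simp: min_def split: if_splits intro: order_trans)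

lemma ramanujan:
  assumes z: "z \<in> uhp"
  shows "3 * qderiv E4 z = E2 z * E4 z - E6 z" "2 * qderiv E6 z = E2 z * E6 z - E4 z * E4 z"
proof -
  note R = Eisenstein_fps_radius
  note r = norm_qpar_less_radius[OF z]
  have rm: "fps_conv_radius (f * g) \<ge> 1" if "fps_conv_radius f \<ge> 1" "fps_conv_radius g \<ge> 1" for f g :: "complex fps"
    using fps_conv_radius_mult[of f g] that by (auto simp: min_def split: if_splits)
  note q = qderiv_eq_eval_fps[OF R(2) Eisenstein_eq_eval_fps(2) z] qderiv_eq_eval_fps[OF R(3) Eisenstein_eq_eval_fps(3) z]
  have "eval_fps (fps_const 3 * (fps_X * fps_deriv E4_fps)) (qpar z) = eval_fps (E2_fps * E4_fps - E6_fps) (qpar z)"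
    by (simp only: ramanujan_fps_E4)
  then show "3 * qderiv E4 z = E2 z * E4 z - E6 z"
    using q r[OF R(1)] r[OF R(2)] r[OF R(3)] r[OF rm[OF R(1,2)]] r[OF fps_X_deriv_radius[OF R(2)]]
    by (subst (asm) eval_fps_mult, simp, simp) (simp add: eval_fps_diff eval_fps_mult Eisenstein_eq_eval_fps[OF z])
  have "eval_fps (fps_const 2 * (fps_X * fps_deriv E6_fps)) (qpar z) = eval_fps (E2_fps * E6_fps - E4_fps * E4_fps) (qpar z)"
    by (simp only: ramanujan_fps_E6)
  then show "2 * qderiv E6 z = E2 z * E6 z - E4 z * E4 z"
    using q r[OF R(1)] r[OF R(2)] r[OF R(3)] r[OF rm[OF R(1,3)]] r[OF rm[OF R(2,2)]] r[OF fps_X_deriv_radius[OF R(3)]]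
    by (subst (asm) eval_fps_mult, simp, simp) (simp add: eval_fps_diff eval_fps_mult Eisenstein_eq_eval_fps[OF z])
qed

section \<open>Hilbert's basis theorem\<close>

text \<open>The ring as a module over itself: \<open>ideal.span\<close> is the generated ideal, and
  the general theory of spans applies to it.\<close>

interpretation ideal: module "(*) :: 'a \<Rightarrow> 'a \<Rightarrow> 'a :: comm_ring_1"
  by standard (simp_all add: algebra_simps)

declare ideal.scale_scale [simp del]

text \<open>The finite generating set is taken inside \<open>S\<close> and not merely inside the
  ideal of \<open>S\<close>. Applied to the range of a sequence, this bounds the sequence by one of
  its own initial segments.\<close>

definition noetherian :: "'a::comm_ring_1 itself \<Rightarrow> bool" where
  "noetherian _ \<longleftrightarrow> (\<forall>S::'a set. \<exists>F\<subseteq>S. finite F \<and> S \<subseteq> ideal.span F)"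

lemma in_span_finite_subset:
  assumes "x \<in> ideal.span S"
  shows "\<exists>T. finite T \<and> T \<subseteq> S \<and> x \<in> ideal.span T"
  using assms
proof (induction rule: ideal.span_induct_alt)
  case base
  show ?case by (rule exI[of _ "{}"]) simp
next
  case (step c x y)
  then obtain T where T: "finite T" "T \<subseteq> S" "y \<in> ideal.span T" by blast
  have "y \<in> ideal.span (insert x T)"
    using T(3) ideal.span_mono[of T "insert x T"] by blast
  moreover have "c * x \<in> ideal.span (insert x T)"
    by (rule ideal.span_scale, rule ideal.span_base) simp
  ultimately have "c * x + y \<in> ideal.span (insert x T)"
    by (rule ideal.span_add[rotated])
  with T step.hyps show ?case by (intro exI[of _ "insert x T"]) simp
qed

lemma finite_subset_span:
  assumes "finite F" "F \<subseteq> ideal.span S"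
  shows "\<exists>G. finite G \<and> G \<subseteq> S \<and> F \<subseteq> ideal.span G"
  using assms
proof (induction F rule: finite_induct)
  case empty
  show ?case by (rule exI[of _ "{}"]) simp
next
  case (insert x F)
  then obtain G where G: "finite G" "G \<subseteq> S" "F \<subseteq> ideal.span G" by auto
  obtain T where T: "finite T" "T \<subseteq> S" "x \<in> ideal.span T"
    using in_span_finite_subset[of x S] insert.prems by auto
  have "ideal.span G \<subseteq> ideal.span (G \<union> T)" "ideal.span T \<subseteq> ideal.span (G \<union> T)"
    by (rule ideal.span_mono, simp)+
  with G T show ?case by (intro exI[of _ "G \<union> T"]) auto
qed

lemma noetherian_field: "noetherian TYPE('a::field)"
  unfolding noetherian_def
proof
  fix S :: "'a set"
  show "\<exists>F\<subseteq>S. finite F \<and> S \<subseteq> ideal.span F"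
  proof (cases "S \<subseteq> {0}")
    case True
    then show ?thesis by (intro exI[of _ "{}"]) simp
  next
    case False
    then obtain u where u: "u \<in> S" "u \<noteq> 0" by auto
    have "v \<in> ideal.span {u}" for v
      using ideal.span_scale[OF ideal.span_base[of u "{u}"], of "v / u"] u by simp
    with u show ?thesis by (intro exI[of _ "{u}"]) auto
  qed
qed

lemma in_span_image_initial_segment:
  fixes a :: "nat \<Rightarrow> 'a::comm_ring_1"
  assumes "x \<in> ideal.span (a ` {..<N})"
  shows "\<exists>c. x = (\<Sum>j<N. c j * a j)"
  using assms
proof (induction rule: ideal.span_induct_alt)
  case base
  then show ?case by (intro exI[of _ "\<lambda>_. 0"]) simp
next
  case (step c x y)
  then obtain d k where d: "y = (\<Sum>j<N. d j * a j)" and k: "k < N" "x = a k" by auto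
  have "c * x + y = (\<Sum>j<N. (d j + (if j = k then c else 0)) * a j)"
    using k by (simp add: d distrib_right sum.distrib sum.delta if_distrib[of "\<lambda>u. u * _"] cong: if_cong)
  then show ?case by (rule exI[where x = "\<lambda>j. d j + (if j = k then c else 0)"])
qed

text \<open>If some ideal resists, polynomials of least degree outside the ideal of their
  predecessors can be chosen forever. Finite generation of the ideal of their leading coefficients
  lets one leading term be cancelled by earlier ones, against minimality.\<close>

theorem noetherian_poly:
  assumes "noetherian TYPE('a::comm_ring_1)"
  shows "noetherian TYPE('a poly)"
  unfolding noetherian_def
proof (rule allI, rule ccontr)
  fix S :: "'a poly set"
  assume S: "\<not> (\<exists>F\<subseteq>S. finite F \<and> S \<subseteq> ideal.span F)"
  let ?I = "ideal.span S"
  \<comment> \<open>A finite subset of \<open>?I\<close> lies in the ideal of finitely many members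
    of \<open>S\<close>, so failure for \<open>S\<close> rules out every finite subset of
    \<open>?I\<close>.\<close>
  have fin: "\<exists>p. p \<in> ?I - ideal.span F" if F: "finite F" "F \<subseteq> ?I" for F
  proof (rule ccontr)
    assume "\<not> (\<exists>p. p \<in> ?I - ideal.span F)"
    then have I: "?I \<subseteq> ideal.span F" by auto
    obtain G where G: "finite G" "G \<subseteq> S" "F \<subseteq> ideal.span G"
      using finite_subset_span[OF F] by blast
    then have "ideal.span F \<subseteq> ideal.span G"
      by (intro ideal.span_minimal) auto
    with I have "S \<subseteq> ideal.span G" using ideal.span_superset[of S] by blast
    with G S show False by blast
  qed
  define least where "least F p \<longleftrightarrow> p \<in> ?I - ideal.span F \<and> (\<forall>q \<in> ?I - ideal.span F. degree p \<le> degree q)" for F p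
  have least: "\<exists>p. least F p" if "finite F" "F \<subseteq> ?I" for F
    using fin[OF that] ex_has_least_nat[of "\<lambda>p. p \<in> ?I - ideal.span F" _ degree]
    unfolding least_def by blast
  have "\<exists>g. \<forall>n::nat. least (g ` {..<n}) (g n)"
  proof (rule dependent_wellorder_choice[where P = "\<lambda>g n p. least (g ` {..<n}) p"])
    fix r and f g :: "nat \<Rightarrow> 'a poly" and n :: nat
    assume "\<And>m. m < n \<Longrightarrow> f m = g m"
    then have "f ` {..<n} = g ` {..<n}" by auto
    then show "least (f ` {..<n}) r = least (g ` {..<n}) r" by simp
  next
    fix n and f :: "nat \<Rightarrow> 'a poly"
    assume "\<And>m. m < n \<Longrightarrow> least (f ` {..<m}) (f m)"
    then show "\<exists>r. least (f ` {..<n}) r"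
      by (intro least) (auto simp: least_def)
  qed
  then obtain g :: "nat \<Rightarrow> 'a poly" where g: "\<And>n. least (g ` {..<n}) (g n)" by blast
  have gI: "g n \<in> ?I" and gn: "g n \<notin> ideal.span (g ` {..<n})" for n
    using g[of n] by (auto simp: least_def)
  \<comment> \<open>\<open>g n\<close> was already a candidate when \<open>g m\<close> was chosen,
    since it also avoids the smaller ideal of the first m choices.\<close>
  have mono: "degree (g m) \<le> degree (g n)" if "m \<le> n" for m n
  proof -
    have "g ` {..<m} \<subseteq> g ` {..<n}" using that by auto
    from ideal.span_mono[OF this] have "g n \<notin> ideal.span (g ` {..<m})"
      using gn[of n] by blast
    with gI g[of m] show ?thesis by (auto simp: least_def)
  qed
  obtain F where F: "F \<subseteq> range (\<lambda>n. lead_coeff (g n))" "finite F" "range (\<lambda>n. lead_coeff (g n)) \<subseteq> ideal.span F"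
    using assms unfolding noetherian_def by meson
  obtain J where J: "finite J" "F = (\<lambda>n. lead_coeff (g n)) ` J"
    using finite_subset_image[OF F(2,1)] by blast
  obtain N where N: "J \<subseteq> {..<N}"
    using J(1) finite_nat_iff_bounded by blast
  have "F \<subseteq> (\<lambda>n. lead_coeff (g n)) ` {..<N}" using J N by auto
  from F(3) ideal.span_mono[OF this] have "lead_coeff (g N) \<in> ideal.span ((\<lambda>n. lead_coeff (g n)) ` {..<N})"
    by blast
  then obtain c where c: "lead_coeff (g N) = (\<Sum>j<N. c j * lead_coeff (g j))"
    using in_span_image_initial_segment by blast
  \<comment> \<open>Each \<open>g j\<close> is lifted to the degree of \<open>g N\<close>, possible
    by \<open>mono\<close>, so that \<open>s\<close> and \<open>g N\<close> have the same
    coefficient in that degree.\<close>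
  define s where "s = (\<Sum>j<N. monom (c j) (degree (g N) - degree (g j)) * g j)"
  have s: "s \<in> ideal.span (g ` {..<N})"
    unfolding s_def by (intro ideal.span_sum ideal.span_scale ideal.span_base) auto
  then have sI: "s \<in> ?I"
    using ideal.span_minimal[of "g ` {..<N}" ?I] gI by auto
  have nin: "g N - s \<notin> ideal.span (g ` {..<N})"
  proof
    assume "g N - s \<in> ideal.span (g ` {..<N})"
    from ideal.span_add[OF this s] gn[of N] show False by simp
  qed
  have "degree (monom (c j) (degree (g N) - degree (g j)) * g j) \<le> degree (g N)" if "j < N" for j
    using degree_mult_le[of "monom (c j) (degree (g N) - degree (g j))" "g j"]
      degree_monom_le[of "c j" "degree (g N) - degree (g j)"] mono[of j N] that by linarith
  then have degs: "degree s \<le> degree (g N)"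
    unfolding s_def by (intro degree_sum_le) auto
  have "coeff (monom (c j) (degree (g N) - degree (g j)) * g j) (degree (g N)) = c j * lead_coeff (g j)" if "j < N" for j
    using mono[of j N] that by (simp add: coeff_monom_mult)
  then have "coeff s (degree (g N)) = (\<Sum>j<N. c j * lead_coeff (g j))"
    unfolding s_def coeff_sum by (intro sum.cong) auto
  then have z: "coeff (g N - s) (degree (g N)) = 0"
    unfolding coeff_diff c by (rule right_minus_eq[THEN iffD2, OF sym])
  have "g N - s \<in> ?I - ideal.span (g ` {..<N})"
    using nin ideal.span_diff[OF gI sI] by blast
  then have "degree (g N) \<le> degree (g N - s)"
    using g[of N] unfolding least_def by blast
  moreover have "degree (g N - s) \<le> degree (g N)"
    using degs by (intro degree_diff_le) auto
  \<comment> \<open>By minimality the degree cannot drop, yet the coefficient there is 0; so the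
    difference is the zero polynomial. This includes degree 0, where no drop is possible at
    all.\<close>
  ultimately have "lead_coeff (g N - s) = 0" using z by simp
  then have "g N - s = 0" by (rule leading_coeff_0_iff[THEN iffD1])
  then show False using nin ideal.span_zero by metis
qed

lemma noetherian_sequence_stabilises:
  fixes a :: "nat \<Rightarrow> 'a::comm_ring_1"
  assumes "noetherian TYPE('a)"
  shows "\<exists>N. \<forall>n. \<exists>c. a n = (\<Sum>j<N. c j * a j)"
proof -
  from assms[unfolded noetherian_def, rule_format, of "range a"]
  obtain F where F: "F \<subseteq> range a" "finite F" "range a \<subseteq> ideal.span F" by blast
  obtain J where J: "finite J" "F = a ` J"
    using finite_subset_image[OF F(2,1)] by blast
  obtain N where N: "J \<subseteq> {..<N}"
    using J(1) finite_nat_iff_bounded by blast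
  have "F \<subseteq> a ` {..<N}" using J N by auto
  with F(3) ideal.span_mono[OF this] have "a n \<in> ideal.span (a ` {..<N})" for n
    by blast
  then have "\<forall>n. \<exists>c. a n = (\<Sum>j<N. c j * a j)"
    by (intro allI in_span_image_initial_segment)
  then show ?thesis ..
qed

text \<open>This is the Noetherian property of a free module of finite rank, in coordinates.
  Subtracting a combination of the first N0 rows clears column i of every row, and the induction
  hypothesis handles the other columns.\<close>

lemma noetherian_rows_stabilise:
  fixes R :: "nat \<Rightarrow> 'i \<Rightarrow> 'a::comm_ring_1"
  assumes noeth: "noetherian TYPE('a)" and "finite I"
  shows "\<exists>N. \<forall>n. \<exists>c. \<forall>i\<in>I. R n i = (\<Sum>j<N. c j * R j i)"
  using \<open>finite I\<close>
proof (induction I arbitrary: R rule: finite_induct)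
  case empty
  then show ?case by simp
next
  case (insert i I)
  obtain N0 where "\<forall>n. \<exists>c. R n i = (\<Sum>j<N0. c j * R j i)"
    using noetherian_sequence_stabilises[OF noeth, of "\<lambda>n. R n i"] by blast
  then obtain c where c: "\<And>n. R n i = (\<Sum>j<N0. c n j * R j i)" by metis
  define R' where "R' n k = R n k - (\<Sum>j<N0. c n j * R j k)" for n k
  obtain N1 where "\<forall>n. \<exists>d. \<forall>k\<in>I. R' n k = (\<Sum>j<N1. d j * R' j k)"
    using insert.IH[of R'] by blast
  then obtain d where d: "\<And>n k. k \<in> I \<Longrightarrow> R' n k = (\<Sum>j<N1. d n j * R' j k)" by metis
  have "R' n i = 0" for n
    unfolding R'_def by (rule right_minus_eq[THEN iffD2, OF c])
  with d have d': "R' n k = (\<Sum>j<N1. d n j * R' j k)" if "k \<in> insert i I" for n k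
    using that by auto
  \<comment> \<open>These are the coefficients obtained by expanding each \<open>R'\<close> in the
    relation for \<open>R'\<close> back into rows of \<open>R\<close>.\<close>
  define e where "e n j = (if j < N1 then d n j else 0) +
      (if j < N0 then c n j - (\<Sum>l<N1. d n l * c l j) else 0)" for n j
  have "R n k = (\<Sum>j<max N0 N1. e n j * R j k)" if k: "k \<in> insert i I" for n k
  proof -
    have ext: "(\<Sum>j<max N0 N1. (if j < M then f j else 0) * R j k) = (\<Sum>j<M. f j * R j k)"
      if "M \<le> max N0 N1" for M f
      using that by (intro sum.mono_neutral_cong_right) auto
    have "R n k = R' n k + (\<Sum>j<N0. c n j * R j k)" by (simp add: R'_def)
    also have "R' n k = (\<Sum>l<N1. d n l * R' l k)" by (rule d'[OF k])
    also have "\<dots> = (\<Sum>l<N1. d n l * R l k) - (\<Sum>l<N1. \<Sum>j<N0. d n l * c l j * R j k)"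
      by (simp add: R'_def right_diff_distrib sum_subtractf sum_distrib_left mult.assoc)
    also have "(\<Sum>l<N1. \<Sum>j<N0. d n l * c l j * R j k) = (\<Sum>j<N0. (\<Sum>l<N1. d n l * c l j) * R j k)"
      by (subst sum.swap) (simp add: sum_distrib_right)
    finally have "R n k = (\<Sum>l<N1. d n l * R l k) + (\<Sum>j<N0. (c n j - (\<Sum>l<N1. d n l * c l j)) * R j k)"
      by (simp add: left_diff_distrib sum_subtractf)
    then show ?thesis
      by (simp add: e_def distrib_right sum.distrib ext)
  qed
  then show ?case by blast
qed

section \<open>The action of the ring of modular forms\<close>

text \<open>An additive \<open>T\<close> commuting with the scalars \<open>s\<close> turns a module
  over a ring into one over its polynomial ring, the variable acting as \<open>T\<close>. The fold
  is Horner's scheme.\<close>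

definition poly_act :: "('a::zero \<Rightarrow> 'b \<Rightarrow> 'b) \<Rightarrow> ('b \<Rightarrow> 'b) \<Rightarrow> 'a poly \<Rightarrow> 'b \<Rightarrow> 'b::ab_group_add" where
  "poly_act s T p v = fold_coeffs (\<lambda>c w. s c v + T w) p 0"

lemma poly_act_0 [simp]: "poly_act s T 0 v = 0"
  by (simp add: poly_act_def)

lemma additive_zero:
  fixes T :: "'b::ab_group_add \<Rightarrow> 'b"
  assumes "\<And>x y. T (x + y) = T x + T y"
  shows "T 0 = 0"
  using assms[of 0 0] by simp

lemma poly_act_pCons:
  assumes "module s" and "\<And>x y. T (x + y) = T x + T y"
  shows "poly_act s T (pCons c p) v = s c v + T (poly_act s T p v)"
proof -
  interpret module s by fact
  \<comment> \<open>For the zero polynomial the fold is empty, and the equation then rests on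
    \<open>T 0 = 0\<close>.\<close>
  show ?thesis
    using additive_zero[of T, OF assms(2)]
    by (cases "c = 0 \<and> p = 0") (auto simp: poly_act_def)
qed

lemma poly_act_commute:
  assumes s: "module s" and T: "\<And>x y. T (x + y) = T x + T y"
    and L: "\<And>x y. L (x + y) = L x + L y" "\<And>c x. L (s c x) = s c (L x)" "\<And>x. L (T x) = T (L x)"
  shows "L (poly_act s T p v) = poly_act s T p (L v)"
  using additive_zero[of L, OF L(1)]
  by (induction p) (simp_all add: poly_act_pCons[OF s T] L)

lemma module_poly_act:
  assumes s: "module s" and T: "\<And>x y. T (x + y) = T x + T y" and sT: "\<And>c x. T (s c x) = s c (T x)"
  shows "module (poly_act s T)"
proof -
  interpret module s by fact
  note pCons = poly_act_pCons[OF s T]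
  have add: "poly_act s T (p + q) x = poly_act s T p x + poly_act s T q x" for p q x
    by (induction p q rule: poly_induct2) (simp_all add: pCons T scale_left_distrib algebra_simps)
  have right: "poly_act s T p (x + y) = poly_act s T p x + poly_act s T p y" for p x y
    by (induction p) (simp_all add: pCons T scale_right_distrib algebra_simps)
  have sc: "poly_act s T (smult a p) x = s a (poly_act s T p x)" for a p x
    by (induction p) (simp_all add: pCons sT scale_right_distrib)
  have TT: "poly_act s T p (T x) = T (poly_act s T p x)" for p x
    by (rule poly_act_commute[OF s T, symmetric]) (simp_all add: T sT)
  show ?thesis
  proof
    fix p q :: "'a poly" and x y :: 'b
    show "poly_act s T p (x + y) = poly_act s T p x + poly_act s T p y" by (rule right)
    show "poly_act s T (p + q) x = poly_act s T p x + poly_act s T q x" by (rule add)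
    show "poly_act s T p (poly_act s T q x) = poly_act s T (p * q) x"
      by (induction p) (simp_all add: pCons add sc TT)
    show "poly_act s T 1 x = x"
      using additive_zero[of T, OF T] by (simp add: one_pCons pCons)
  qed
qed

definition scale_act :: "complex \<Rightarrow> hop" where
  "scale_act c h = (\<lambda>n z. c * h n z)"

text \<open>Multiplication by the homogeneous element (g, l). The function g is arbitrary so that,
  besides \<open>e4\<close> and \<open>e6\<close>, multiplication by iterated derivatives of one
  factor of a product is covered.\<close>

definition mult_act :: "(complex \<Rightarrow> complex) \<Rightarrow> real \<Rightarrow> hop" where
  "mult_act g l h = (\<lambda>n z. g z * h (n - l) z)"

text \<open>The inner variable acts as \<open>e4\<close> and the outer one as \<open>e6\<close>. The
  scalar ring C[X][Y] is Noetherian by two uses of Hilbert's theorem.\<close>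

definition act :: "complex poly poly \<Rightarrow> hop" where
  "act = poly_act (poly_act scale_act e4) e6"

lemma module_scale_act: "module scale_act"
  by standard (simp_all add: scale_act_def fun_eq_iff algebra_simps)

lemma e4_eq_mult_act: "e4 = mult_act E4 4" and e6_eq_mult_act: "e6 = mult_act E6 6"
  by (simp_all add: fun_eq_iff e4_def e6_def mult_act_def)

lemma mult_act_add: "mult_act g l (x + y) = mult_act g l x + mult_act g l y"
  by (simp add: mult_act_def fun_eq_iff algebra_simps)

lemma mult_act_scale_act: "mult_act g l (scale_act c x) = scale_act c (mult_act g l x)"
  by (simp add: mult_act_def scale_act_def fun_eq_iff)

lemma mult_act_commute: "mult_act g l (mult_act f k x) = mult_act f k (mult_act g l x)"
  by (simp add: mult_act_def fun_eq_iff algebra_simps)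

lemma module_poly_act_e4: "module (poly_act scale_act e4)"
  unfolding e4_eq_mult_act
  by (rule module_poly_act[OF module_scale_act]) (rule mult_act_add mult_act_scale_act)+

lemma mult_act_poly_act: "mult_act g l (poly_act scale_act e4 p x) = poly_act scale_act e4 p (mult_act g l x)"
  unfolding e4_eq_mult_act
  by (rule poly_act_commute[OF module_scale_act])
     (rule mult_act_add mult_act_scale_act mult_act_commute)+

lemma module_act: "module act"
  unfolding act_def e6_eq_mult_act
  by (rule module_poly_act[OF module_poly_act_e4]) (rule mult_act_add mult_act_poly_act)+

interpretation H: module act
  by (rule module_act)

lemma mult_act_act: "mult_act g l (act p x) = act p (mult_act g l x)"
  unfolding act_def e6_eq_mult_act
  by (rule poly_act_commute[OF module_poly_act_e4])
     (rule mult_act_add mult_act_poly_act mult_act_commute)+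

lemma e4_add: "e4 (x + y) = e4 x + e4 y" and e6_add: "e6 (x + y) = e6 x + e6 y"
  by (simp_all add: e4_eq_mult_act e6_eq_mult_act mult_act_add)

lemma act_const: "act [:[:c:]:] h = scale_act c h"
  using additive_zero[of e4, OF e4_add] additive_zero[of e6, OF e6_add]
  by (simp add: act_def poly_act_pCons[OF module_poly_act_e4 e6_add] poly_act_pCons[OF module_scale_act e4_add] del: plus_fun_apply zero_fun_apply)

lemma act_e4: "act [:[:0, 1:]:] = e4"
proof
  interpret s: module scale_act by (rule module_scale_act)
  show "act [:[:0, 1:]:] h = e4 h" for h
  using additive_zero[of e4, OF e4_add] additive_zero[of e6, OF e6_add]
  by (simp add: act_def poly_act_pCons[OF module_poly_act_e4 e6_add] poly_act_pCons[OF module_scale_act e4_add] del: plus_fun_apply zero_fun_apply)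
qed

lemma act_e6: "act [:0, 1:] = e6"
proof
  interpret s: module scale_act by (rule module_scale_act)
  interpret t: module "poly_act scale_act e4" by (rule module_poly_act_e4)
  show "act [:0, 1:] h = e6 h" for h
    using additive_zero[of e6, OF e6_add]
    by (simp add: act_def poly_act_pCons[OF module_poly_act_e4 e6_add] del: plus_fun_apply zero_fun_apply)
qed

text \<open>Coefficients of operators become polynomials, so linear algebra over a commutative ring
  is available for them.\<close>

lemma Mops_eq_range_act: "Mops = range act"
proof (intro equalityI subsetI)
  fix a assume "a \<in> Mops"
  then have "\<exists>p. a = act p"
  proof induction
    case M_id
    have "id = act 1" by (simp add: fun_eq_iff)
    then show ?case ..
  next
    case M_e4
    show ?case by (rule exI, rule act_e4[symmetric])
  next
    case M_e6
    show ?case by (rule exI, rule act_e6[symmetric])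
  next
    case (M_add a b)
    then obtain p q where "a = act p" "b = act q" by blast
    then have "op_add a b = act (p + q)"
      by (simp add: op_add_def H.scale_left_distrib fun_eq_iff)
    then show ?case ..
  next
    case (M_smult a c)
    then obtain p where "a = act p" by blast
    then have "op_smult c a h = act [:[:c:]:] (act p h)" for h
      by (simp add: act_const op_smult_def scale_act_def del: H.scale_scale)
    then have "op_smult c a = act ([:[:c:]:] * p)"
      unfolding H.scale_scale by blast
    then show ?case ..
  next
    case (M_comp a b)
    then obtain p q where "a = act p" "b = act q" by blast
    then have "a \<circ> b = act (p * q)" by (simp add: comp_def)
    then show ?case ..
  qed
  then show "a \<in> range act" by blast
next
  fix a assume "a \<in> range act"
  then obtain p where a: "a = act p" by blast
  have c: "act [:[:c:]:] \<in> Mops" for c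
  proof -
    have "act [:[:c:]:] = op_smult c id" by (simp add: fun_eq_iff act_const scale_act_def op_smult_def)
    then show ?thesis using M_id M_smult by simp
  qed
  have add: "act (p + q) \<in> Mops" if "act p \<in> Mops" "act q \<in> Mops" for p q
  proof -
    have "act (p + q) = op_add (act p) (act q)" by (simp add: op_add_def H.scale_left_distrib fun_eq_iff)
    then show ?thesis using M_add that by simp
  qed
  have mult: "act (p * q) \<in> Mops" if "act p \<in> Mops" "act q \<in> Mops" for p q
  proof -
    have "act (p * q) = act p \<circ> act q" by (simp add: fun_eq_iff)
    then show ?thesis using M_comp that by simp
  qed
  have q: "act [:q:] \<in> Mops" for q
  proof (induction q)
    case 0
    show ?case using c[of 0] unfolding pCons_0_0 .
  next
    case (pCons a q)
    have "act ([:[:a:]:] + [:[:0, 1:]:] * [:q:]) \<in> Mops"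
      by (intro add mult c pCons.IH) (simp add: act_e4 M_e4)
    then show ?case by simp
  qed
  have "act p \<in> Mops"
  proof (induction p)
    case 0
    show ?case using q[of 0] unfolding pCons_0_0 .
  next
    case (pCons a p)
    have "act ([:a:] + [:0, 1:] * p) \<in> Mops"
      by (intro add mult q pCons.IH) (simp add: act_e6 M_e6)
    then show ?case by simp
  qed
  then show "a \<in> Mops" by (simp add: a)
qed

section \<open>Equality on the upper half plane and holomorphic elements\<close>

definition Hol :: "hel set" where
  "Hol = {h. \<forall>n. h n holomorphic_on uhp}"

text \<open>Equality in H proper: a \<open>hel\<close> has arbitrary values off \<open>uhp\<close>,
  and the identities between Eisenstein series are available only on \<open>uhp\<close>.\<close>

definition heq :: "hel \<Rightarrow> hel \<Rightarrow> bool" where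
  "heq h h' \<longleftrightarrow> (\<forall>n. \<forall>z\<in>uhp. h n z = h' n z)"

lemma heq_refl [simp]: "heq h h"
  and heq_sym: "heq h h' \<Longrightarrow> heq h' h"
  and heq_trans: "heq h h' \<Longrightarrow> heq h' h'' \<Longrightarrow> heq h h''"
  and heq_add: "heq h h' \<Longrightarrow> heq k k' \<Longrightarrow> heq (h + k) (h' + k')"
  and heq_mult_act: "heq h h' \<Longrightarrow> heq (mult_act g l h) (mult_act g l h')"
  by (auto simp: heq_def mult_act_def)

lemma heq_zero_iff: "heq h 0 \<longleftrightarrow> hzero h"
  by (simp add: heq_def hzero_def)

lemma heq_iff_hzero: "heq h h' \<longleftrightarrow> hzero (h - h')"
  by (simp add: heq_def hzero_def)

lemma heq_Mops:
  assumes "a \<in> Mops" "heq h h'"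
  shows "heq (a h) (a h')"
  using assms
proof (induction arbitrary: h h')
  case (M_add a b)
  from M_add.IH(1)[OF M_add.prems] M_add.IH(2)[OF M_add.prems] show ?case
    by (simp add: heq_def op_add_def)
next
  case (M_smult a c)
  from M_smult.IH[OF M_smult.prems] show ?case
    by (simp add: heq_def op_smult_def)
qed (auto simp: e4_eq_mult_act e6_eq_mult_act heq_mult_act)

lemma act_in_Mops: "act p \<in> Mops"
  by (simp add: Mops_eq_range_act)

lemma heq_act: "heq h h' \<Longrightarrow> heq (act p h) (act p h')"
  by (rule heq_Mops[OF act_in_Mops])

lemma hzero_act: "hzero h \<Longrightarrow> hzero (act p h)"
  using heq_act[of h 0 p] by (simp add: heq_zero_iff del: zero_fun_apply)

lemma Hol_heq: "h \<in> Hol \<Longrightarrow> heq h h' \<Longrightarrow> h' \<in> Hol"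
  unfolding Hol_def heq_def by (auto cong: holomorphic_cong)

lemma Hol_0: "0 \<in> Hol"
  by (simp add: Hol_def zero_fun_def)

lemma Hol_hzero: "hzero h \<Longrightarrow> h \<in> Hol"
  using Hol_heq[OF Hol_0 heq_sym] heq_zero_iff by blast

lemma Hol_add: "h \<in> Hol \<Longrightarrow> h' \<in> Hol \<Longrightarrow> h + h' \<in> Hol"
  by (auto simp: Hol_def plus_fun_def intro: holomorphic_on_add)

lemma Hol_mult_act: "g holomorphic_on uhp \<Longrightarrow> h \<in> Hol \<Longrightarrow> mult_act g l h \<in> Hol"
  by (auto simp: Hol_def mult_act_def intro: holomorphic_on_mult)

lemma Hol_Mops: "a \<in> Mops \<Longrightarrow> h \<in> Hol \<Longrightarrow> a h \<in> Hol"
proof (induction arbitrary: h rule: Mops.induct)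
  case (M_add a b)
  then have "a h + b h \<in> Hol" by (intro Hol_add) auto
  then show ?case by (simp add: op_add_def plus_fun_def)
next
  case (M_smult a c)
  then show ?case by (auto simp: Hol_def op_smult_def intro!: holomorphic_intros)
qed (auto simp: e4_eq_mult_act e6_eq_mult_act intro: Hol_mult_act holomorphic_Eisenstein)

lemma Hol_act: "h \<in> Hol \<Longrightarrow> act p h \<in> Hol"
  by (rule Hol_Mops[OF act_in_Mops])

section \<open>The Serre derivative and its commutation with modular forms\<close>

lemma holomorphic_serre:
  assumes "f holomorphic_on uhp"
  shows "serre k f holomorphic_on uhp"
  unfolding serre_def qderiv_def
  by (intro holomorphic_intros holomorphic_Eisenstein holomorphic_deriv[OF assms open_uhp] assms) auto

lemma Hol_delta: "h \<in> Hol \<Longrightarrow> delta h \<in> Hol"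
  by (auto simp: Hol_def delta_def intro: holomorphic_serre)

lemma differentiable_uhp: "f holomorphic_on uhp \<Longrightarrow> z \<in> uhp \<Longrightarrow> f field_differentiable at z"
  by (rule holomorphic_on_imp_differentiable_at[OF _ open_uhp])

lemma serre_cong:
  assumes "\<And>z. z \<in> uhp \<Longrightarrow> f z = g z" "z \<in> uhp"
  shows "serre k f z = serre k g z"
proof -
  have "deriv f z = deriv g z"
    using assms open_uhp by (intro deriv_cong_ev) (auto simp: eventually_nhds)
  then show ?thesis using assms by (simp add: serre_def qderiv_def)
qed

lemma serre_add:
  assumes "f holomorphic_on uhp" "g holomorphic_on uhp" "z \<in> uhp"
  shows "serre k (\<lambda>z. f z + g z) z = serre k f z + serre k g z"
  using differentiable_uhp assms by (simp add: serre_def qderiv_def add_divide_distrib algebra_simps)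

lemma serre_smult:
  assumes "f holomorphic_on uhp" "z \<in> uhp"
  shows "serre k (\<lambda>z. c * f z) z = c * serre k f z"
  using differentiable_uhp assms by (simp add: serre_def qderiv_def algebra_simps)

text \<open>The weight enters linearly, so the E2 terms of weights k and l add up to that of weight
  k + l.\<close>

lemma serre_mult:
  assumes "f holomorphic_on uhp" "g holomorphic_on uhp" "z \<in> uhp"
  shows "serre (k + l) (\<lambda>z. f z * g z) z = serre k f z * g z + f z * serre l g z"
proof -
  have "deriv (\<lambda>z. f z * g z) z = f z * deriv g z + deriv f z * g z"
    using differentiable_uhp assms by (intro deriv_mult) auto
  then show ?thesis
    by (simp add: serre_def qderiv_def add_divide_distrib algebra_simps)
qed

lemma heq_delta: "heq h h' \<Longrightarrow> heq (delta h) (delta h')"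
  by (auto simp: heq_def delta_def intro: serre_cong)

lemma delta_add: "h \<in> Hol \<Longrightarrow> h' \<in> Hol \<Longrightarrow> heq (delta (h + h')) (delta h + delta h')"
  by (simp add: heq_def delta_def Hol_def plus_fun_def serre_add)

lemma serre_zero: "serre k (\<lambda>_. 0) = (\<lambda>_. 0)"
  by (simp add: serre_def qderiv_def fun_eq_iff)

lemma delta_0: "delta 0 = 0"
  by (simp add: delta_def zero_fun_def serre_zero)

lemma delta_mult_act:
  assumes "g holomorphic_on uhp" "h \<in> Hol"
  shows "heq (delta (mult_act g l h)) (mult_act (serre l g) (l + 2) h + mult_act g l (delta h))"
  unfolding heq_def
proof (intro allI ballI)
  fix n z assume z: "z \<in> uhp"
  \<comment> \<open>Component n of the left side differentiates component n - 2 = l + m of the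
    product, which involves component m of \<open>h\<close>.\<close>
  define m where "m = n - (l + 2)"
  have n: "n = l + m + 2" by (simp add: m_def)
  have "serre (l + m) (\<lambda>z. g z * h m z) z = serre l g z * h m z + g z * serre m (h m) z"
    using assms z by (intro serre_mult) (auto simp: Hol_def)
  then show "delta (mult_act g l h) n z = (mult_act (serre l g) (l + 2) h + mult_act g l (delta h)) n z"
    by (simp add: delta_def mult_act_def n)
qed

text \<open>The E2 terms of Ramanujan's formulas are cancelled exactly by the weight terms, 4/12 =
  1/3 and 6/12 = 1/2, and modular forms remain.\<close>

lemma serre_Eisenstein:
  assumes "z \<in> uhp"
  shows "serre 4 E4 z = - 1 / 3 * E6 z" "serre 6 E6 z = - 1 / 2 * (E4 z * E4 z)"
  using ramanujan[OF assms] by (simp_all add: serre_def field_simps)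

lemma op_add_apply: "op_add a b h = a h + b h"
  by (simp add: op_add_def fun_eq_iff)

text \<open>The commutator of \<open>delta\<close> with a multiplication operator is multiplication
  by its Serre derivative. It obeys the product rule, so only the generators have to be inspected,
  and there the derivatives are multiples of E6 and E4^2.\<close>

lemma delta_Mops:
  assumes "a \<in> Mops"
  shows "\<exists>a'\<in>Mops. \<forall>h\<in>Hol. heq (delta (a h)) (a' h + a (delta h))"
  using assms
proof induction
  case M_id
  show ?case
    by (intro bexI[of _ "op_smult 0 id"] M_smult Mops.M_id) (simp add: heq_def op_smult_def)
next
  case M_e4
  show ?case
  proof (intro bexI[of _ "op_smult (- 1 / 3) e6"] M_smult M_e6 ballI)
    fix h assume "h \<in> Hol"
    from delta_mult_act[OF holomorphic_Eisenstein(2) this, of 4]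
    show "heq (delta (e4 h)) (op_smult (- 1 / 3) e6 h + e4 (delta h))"
      by (simp add: heq_def e4_eq_mult_act e6_eq_mult_act op_smult_def) (simp add: mult_act_def serre_Eisenstein)
  qed
next
  case M_e6
  show ?case
  proof (intro bexI[of _ "op_smult (- 1 / 2) (e4 \<circ> e4)"] M_smult M_comp M_e4 ballI)
    fix h assume "h \<in> Hol"
    from delta_mult_act[OF holomorphic_Eisenstein(3) this, of 6]
    show "heq (delta (e6 h)) (op_smult (- 1 / 2) (e4 \<circ> e4) h + e6 (delta h))"
      by (simp add: heq_def e4_eq_mult_act e6_eq_mult_act op_smult_def) (simp add: mult_act_def serre_Eisenstein)
  qed
next
  case (M_add a b)
  from M_add.IH(1) obtain a' where a': "a' \<in> Mops" "\<forall>h\<in>Hol. heq (delta (a h)) (a' h + a (delta h))" by (rule bexE)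
  from M_add.IH(2) obtain b' where b': "b' \<in> Mops" "\<forall>h\<in>Hol. heq (delta (b h)) (b' h + b (delta h))" by (rule bexE)
  note * = a'(1) b'(1) a'(2)[rule_format] b'(2)[rule_format]
  show ?case
  proof (intro bexI[of _ "op_add a' b'"] Mops.M_add * ballI)
    fix h assume h: "h \<in> Hol"
    have "heq (delta (a h + b h)) (delta (a h) + delta (b h))"
      by (rule delta_add[OF Hol_Mops[OF M_add.hyps(1) h] Hol_Mops[OF M_add.hyps(2) h]])
    moreover have "heq (delta (a h) + delta (b h)) ((a' h + a (delta h)) + (b' h + b (delta h)))"
      by (rule heq_add[OF *(3)[OF h] *(4)[OF h]])
    ultimately have "heq (delta (a h + b h)) ((a' h + a (delta h)) + (b' h + b (delta h)))"
      by (rule heq_trans)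
    then show "heq (delta (op_add a b h)) (op_add a' b' h + op_add a b (delta h))"
      unfolding op_add_apply by (simp only: ac_simps)
  qed
next
  case (M_smult a c)
  from M_smult.IH obtain a' where a': "a' \<in> Mops" "\<forall>h\<in>Hol. heq (delta (a h)) (a' h + a (delta h))" by (rule bexE)
  note * = a'(1) a'(2)[rule_format]
  show ?case
  proof (intro bexI[of _ "op_smult c a'"] Mops.M_smult * ballI)
    fix h assume h: "h \<in> Hol"
    then have "a h \<in> Hol" by (rule Hol_Mops[OF M_smult.hyps])
    with *(2)[OF h] show "heq (delta (op_smult c a h)) (op_smult c a' h + op_smult c a (delta h))"
      by (simp add: heq_def op_smult_def delta_def Hol_def serre_smult distrib_left)
  qed
next
  case (M_comp a b)
  from M_comp.IH(1) obtain a' where a': "a' \<in> Mops" "\<forall>h\<in>Hol. heq (delta (a h)) (a' h + a (delta h))" by (rule bexE)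
  from M_comp.IH(2) obtain b' where b': "b' \<in> Mops" "\<forall>h\<in>Hol. heq (delta (b h)) (b' h + b (delta h))" by (rule bexE)
  note * = a'(1) b'(1) a'(2)[rule_format] b'(2)[rule_format]
  obtain p where p: "a = act p" using M_comp.hyps(1) by (auto simp: Mops_eq_range_act)
  show ?case
  proof (intro bexI[of _ "op_add (a' \<circ> b) (a \<circ> b')"] Mops.M_add Mops.M_comp * M_comp.hyps ballI)
    fix h assume h: "h \<in> Hol"
    have "heq (delta (a (b h))) (a' (b h) + a (delta (b h)))"
      by (rule *(3)[OF Hol_Mops[OF M_comp.hyps(2) h]])
    moreover have "heq (a' (b h) + a (delta (b h))) (a' (b h) + a (b' h + b (delta h)))"
      by (rule heq_add[OF heq_refl heq_Mops[OF M_comp.hyps(1) *(4)[OF h]]])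
    ultimately have "heq (delta (a (b h))) (a' (b h) + a (b' h + b (delta h)))"
      by (rule heq_trans)
    moreover have "a (b' h + b (delta h)) = a (b' h) + a (b (delta h))"
      unfolding p by (rule H.scale_right_distrib)
    ultimately show "heq (delta ((a \<circ> b) h)) (op_add (a' \<circ> b) (a \<circ> b') h + (a \<circ> b) (delta h))"
      unfolding op_add_apply comp_apply by (simp only: ac_simps)
  qed
qed

lemma delta_act: "\<exists>q. \<forall>h\<in>Hol. heq (delta (act p h)) (act q h + act p (delta h))"
  using delta_Mops[OF act_in_Mops[of p]] by (auto simp: Mops_eq_range_act)

section \<open>Finitely generated differential modules\<close>

text \<open>Only values on the upper half plane matter in H, so whatever vanishes there is put into every span.\<close>
definition Mspan :: "hel set \<Rightarrow> hel set" where
  "Mspan B = H.span (B \<union> {h. hzero h})"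

lemma Mspan_base: "b \<in> B \<Longrightarrow> b \<in> Mspan B"
  unfolding Mspan_def by (rule H.span_base) simp

lemma Mspan_hzero: "hzero h \<Longrightarrow> h \<in> Mspan B"
  unfolding Mspan_def by (rule H.span_base) simp

lemma Mspan_add: "x \<in> Mspan B \<Longrightarrow> y \<in> Mspan B \<Longrightarrow> x + y \<in> Mspan B"
  and Mspan_act: "x \<in> Mspan B \<Longrightarrow> act p x \<in> Mspan B"
  and Mspan_sum: "(\<And>i. i \<in> I \<Longrightarrow> f i \<in> Mspan B) \<Longrightarrow> sum f I \<in> Mspan B"
  and Mspan_mono: "A \<subseteq> B \<Longrightarrow> Mspan A \<subseteq> Mspan B"
  unfolding Mspan_def by (rule H.span_add H.span_scale H.span_sum H.span_mono; blast)+

lemma Mspan_heq: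
  assumes "x \<in> Mspan B" "heq x y"
  shows "y \<in> Mspan B"
proof -
  have "hzero (y - x)" using heq_sym[OF assms(2)] by (simp only: heq_iff_hzero)
  from Mspan_add[OF assms(1) Mspan_hzero[OF this]] show ?thesis by (simp only: add_diff_cancel_left' add_diff_eq)
qed

text \<open>A null generator contributes only a null term, which the case \<open>heq\<close>
  absorbs; the case \<open>base\<close> therefore sees genuine generators only.\<close>

lemma Mspan_induct [consumes 1, case_names zero base heq]:
  assumes "x \<in> Mspan B" and "\<And>y. hzero y \<Longrightarrow> P y"
    and "\<And>p b y. b \<in> B \<Longrightarrow> P y \<Longrightarrow> P (act p b + y)"
    and "\<And>y y'. P y \<Longrightarrow> heq y y' \<Longrightarrow> P y'"
  shows "P x"
  using assms(1) unfolding Mspan_def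
proof (induction rule: H.span_induct_alt)
  case base
  show ?case by (rule assms(2)) (simp add: hzero_def)
next
  case (step c x y)
  show ?case
  proof (cases "x \<in> B")
    case True
    then show ?thesis using step.IH by (rule assms(3))
  next
    case False
    then have "hzero (act c x)" using step.hyps hzero_act by blast
    then have "heq y (act c x + y)" by (simp add: heq_def hzero_def)
    with step.IH show ?thesis by (rule assms(4))
  qed
qed

lemma Mspan_image_finite:
  assumes "x \<in> Mspan (f ` I)" "finite I"
  shows "\<exists>c. heq x (\<Sum>i\<in>I. act (c i) (f i))"
  using assms(1)
proof (induction rule: Mspan_induct)
  case (zero y)
  then have "heq y (\<Sum>i\<in>I. act 0 (f i))"
    by (simp add: heq_zero_iff del: zero_fun_apply)
  then show ?case by (rule exI[where x = "\<lambda>_. 0"])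
next
  case (base p b y)
  then obtain c k where c: "heq y (\<Sum>i\<in>I. act (c i) (f i))" and k: "k \<in> I" "b = f k" by blast
  have "act p b + (\<Sum>i\<in>I. act (c i) (f i)) = (\<Sum>i\<in>I. act (c i + (if i = k then p else 0)) (f i))"
    using k assms(2) by (simp add: H.scale_left_distrib sum.distrib if_distrib[of "\<lambda>u. act u _"] sum.delta add.commute cong: if_cong del: plus_fun_apply zero_fun_apply)
  with heq_add[OF heq_refl[of "act p b"] c]
  show ?case by (intro exI[of _ "\<lambda>i. c i + (if i = k then p else 0)"]) (simp only:)
next
  case (heq y y')
  then show ?case using heq_trans heq_sym by blast
qed

lemma Mspan_subset_Hol: "B \<subseteq> Hol \<Longrightarrow> x \<in> Mspan B \<Longrightarrow> x \<in> Hol"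
  by (rotate_tac, induction rule: Mspan_induct) (auto intro: Hol_hzero Hol_add Hol_act Hol_heq)

text \<open>Since delta (p b) = q b + p (delta b), the target must contain both the generators and
  their images. Holomorphy is carried through the induction because additivity of
  \<open>delta\<close> is available on \<open>Hol\<close>.\<close>

lemma Mspan_delta:
  assumes B: "B \<subseteq> Hol" "\<And>b. b \<in> B \<Longrightarrow> delta b \<in> Mspan C" "B \<subseteq> Mspan C" and x: "x \<in> Mspan B"
  shows "delta x \<in> Mspan C"
proof -
  from x have "x \<in> Hol \<and> delta x \<in> Mspan C"
  proof (induction rule: Mspan_induct)
    case (zero y)
    then have "heq (delta y) (delta 0)" by (intro heq_delta) (simp only: heq_zero_iff)
    then have "hzero (delta y)" by (simp only: delta_0 heq_zero_iff)
    with zero show ?case by (simp add: Hol_hzero Mspan_hzero)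
  next
    case (base p b y)
    have b: "b \<in> Hol" using base.hyps B(1) by blast
    obtain q where "\<forall>h\<in>Hol. heq (delta (act p h)) (act q h + act p (delta h))"
      using delta_act[of p] by (rule exE)
    with b have "heq (delta (act p b) + delta y) (act q b + act p (delta b) + delta y)"
      by (intro heq_add heq_refl) blast
    then have "heq (delta (act p b + y)) (act q b + act p (delta b) + delta y)"
      by (rule heq_trans[OF delta_add[OF Hol_act[OF b] conjunct1[OF base.IH]]])
    moreover have "act q b + act p (delta b) + delta y \<in> Mspan C"
      using base B by (intro Mspan_add Mspan_act) auto
    ultimately have "delta (act p b + y) \<in> Mspan C"
      using Mspan_heq heq_sym by blast
    then show ?case
      using Hol_add[OF Hol_act[OF b] conjunct1[OF base.IH]] by blast
  next
    case (heq y y')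
    then show ?case using Hol_heq Mspan_heq[OF _ heq_delta] by blast
  qed
  then show ?thesis ..
qed

definition diff_finite :: "hel \<Rightarrow> bool" where
  "diff_finite W \<longleftrightarrow> (\<exists>B. finite B \<and> B \<subseteq> Hol \<and> (\<forall>b\<in>B. delta b \<in> Mspan B) \<and> W \<in> Mspan B)"

lemma diff_finiteI:
  "finite B \<Longrightarrow> B \<subseteq> Hol \<Longrightarrow> (\<And>b. b \<in> B \<Longrightarrow> delta b \<in> Mspan B) \<Longrightarrow> W \<in> Mspan B \<Longrightarrow> diff_finite W"
  unfolding diff_finite_def by (rule exI[of _ B]) simp

lemma diff_finiteE:
  assumes "diff_finite W"
  obtains B where "finite B" "B \<subseteq> Hol" "\<And>b. b \<in> B \<Longrightarrow> delta b \<in> Mspan B" "W \<in> Mspan B"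
  using assms unfolding diff_finite_def by (elim exE conjE) (simp add: Ball_def)

lemma diff_finite_imp_Hol: "diff_finite W \<Longrightarrow> W \<in> Hol"
  by (erule diff_finiteE) (rule Mspan_subset_Hol)

text \<open>Coordinates with respect to \<open>B\<close> need not be unique; any choice of rows
  serves, since a linear relation among the rows implies one among the elements they
  represent.\<close>

lemma diff_finite_recurrence:
  assumes "diff_finite W"
  shows "\<exists>N. (delta ^^ N) W \<in> Mspan ((\<lambda>i. (delta ^^ i) W) ` {..<N})"
proof -
  obtain B where B: "finite B" "B \<subseteq> Hol" "\<forall>b\<in>B. delta b \<in> Mspan B" "W \<in> Mspan B"
    using assms unfolding diff_finite_def by (elim exE conjE)
  have "(delta ^^ n) W \<in> Mspan B" for n
  proof (induction n)
    case (Suc n)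
    have "B \<subseteq> Mspan B" by (auto intro: Mspan_base)
    from Mspan_delta[OF B(2) bspec[OF B(3)] this Suc] show ?case by simp
  qed (simp add: B)
  then have "\<forall>n. \<exists>c. heq ((delta ^^ n) W) (\<Sum>b\<in>B. act (c b) b)"
    by (intro allI Mspan_image_finite[of _ "\<lambda>b. b" B, unfolded image_ident] B(1))
  from choice[OF this] obtain R where "\<forall>n. heq ((delta ^^ n) W) (\<Sum>b\<in>B. act (R n b) b)" ..
  then have R: "heq ((delta ^^ n) W) (\<Sum>b\<in>B. act (R n b) b)" for n by (rule spec)
  from noetherian_rows_stabilise[OF noetherian_poly[OF noetherian_poly[OF noetherian_field]] B(1), of R]
  obtain N where "\<forall>n. \<exists>c. \<forall>b\<in>B. R n b = (\<Sum>j<N. c j * R j b)" ..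
  from spec[OF this, of N] obtain c where c: "\<forall>b\<in>B. R N b = (\<Sum>j<N. c j * R j b)" ..
  have "(\<Sum>b\<in>B. act (R N b) b) = (\<Sum>b\<in>B. \<Sum>j<N. act (c j) (act (R j b) b))"
    by (rule sum.cong) (simp_all only: bspec[OF c] H.scale_sum_left H.scale_scale)
  also have "\<dots> = (\<Sum>j<N. act (c j) (\<Sum>b\<in>B. act (R j b) b))"
    by (subst sum.swap) (simp only: H.scale_sum_right)
  finally have eq: "heq (\<Sum>j<N. act (c j) (\<Sum>b\<in>B. act (R j b) b)) ((delta ^^ N) W)"
    using heq_sym[OF R[of N]] by (simp only:)
  have "(\<Sum>b\<in>B. act (R j b) b) \<in> Mspan ((\<lambda>i. (delta ^^ i) W) ` {..<N})" if "j < N" for j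
    by (rule Mspan_heq[OF Mspan_base R[of j]]) (rule imageI, simp add: that)
  then have "(\<Sum>j<N. act (c j) (\<Sum>b\<in>B. act (R j b) b)) \<in> Mspan ((\<lambda>i. (delta ^^ i) W) ` {..<N})"
    by - (rule Mspan_sum, rule Mspan_act, simp)
  from Mspan_heq[OF this eq] show ?thesis ..
qed

lemma recurrence_closed:
  assumes "(delta ^^ N) W \<in> Mspan ((\<lambda>i. (delta ^^ i) W) ` {..<N})" "i < N"
  shows "delta ((delta ^^ i) W) \<in> Mspan ((\<lambda>i. (delta ^^ i) W) ` {..<N})"
proof -
  have eq: "(delta ^^ Suc i) W = delta ((delta ^^ i) W)" by simp
  show ?thesis
  proof (cases "Suc i = N")
    case True
    from assms(1) show ?thesis unfolding eq[unfolded True, symmetric] .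
  next
    case False
    with assms(2) have "Suc i \<in> {..<N}" by simp
    then have "(delta ^^ Suc i) W \<in> (\<lambda>i. (delta ^^ i) W) ` {..<N}" by (rule imageI)
    from Mspan_base[OF this] show ?thesis unfolding eq .
  qed
qed

lemma Hol_funpow_delta: "W \<in> Hol \<Longrightarrow> (delta ^^ i) W \<in> Hol"
  by (induction i) (auto intro: Hol_delta)

text \<open>A null W admits order 0. Applying \<open>delta\<close> to the relation raises the order
  by one, and a positive order puts W itself among the generators, as products require.\<close>

lemma diff_finite_recurrence_pos:
  assumes "diff_finite W"
  shows "\<exists>N>0. (delta ^^ N) W \<in> Mspan ((\<lambda>i. (delta ^^ i) W) ` {..<N})"
proof -
  let ?B = "\<lambda>N. (\<lambda>i. (delta ^^ i) W) ` {..<N}"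
  obtain N where N: "(delta ^^ N) W \<in> Mspan (?B N)" using diff_finite_recurrence[OF assms] ..
  have "delta ((delta ^^ N) W) \<in> Mspan (?B N)"
  proof (rule Mspan_delta[OF _ _ _ N])
    show "?B N \<subseteq> Hol" using Hol_funpow_delta[OF diff_finite_imp_Hol[OF assms]] by (rule image_subsetI)
    show "delta b \<in> Mspan (?B N)" if "b \<in> ?B N" for b
      using that by (rule imageE) (simp add: recurrence_closed[OF N])
    show "?B N \<subseteq> Mspan (?B N)" by (rule subsetI) (rule Mspan_base)
  qed
  moreover have "?B N \<subseteq> ?B (Suc N)" by (intro image_mono) auto
  ultimately have "(delta ^^ Suc N) W \<in> Mspan (?B (Suc N))"
    using Mspan_mono by (simp only: funpow.simps comp_apply) (rule subsetD)
  then show ?thesis by (intro exI[of _ "Suc N"]) (simp only: zero_less_Suc)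
qed

lemma diff_finite_if_recurrence:
  assumes "W \<in> Hol" "(delta ^^ N) W \<in> Mspan ((\<lambda>i. (delta ^^ i) W) ` {..<N})"
  shows "diff_finite W"
proof (rule diff_finiteI)
  let ?B = "(\<lambda>i. (delta ^^ i) W) ` {..<N}"
  show "finite ?B" by simp
  show "?B \<subseteq> Hol" using Hol_funpow_delta[OF assms(1)] by (rule image_subsetI)
  show "delta b \<in> Mspan ?B" if "b \<in> ?B" for b
    using that by (rule imageE) (simp add: recurrence_closed[OF assms(2)])
  show "W \<in> Mspan ?B"
  proof (cases "N = 0")
    case True
    then show ?thesis using assms(2) by simp
  next
    case False
    then have "(delta ^^ 0) W \<in> ?B" by (intro imageI) simp
    from Mspan_base[OF this] show ?thesis by (simp only: funpow.simps id_apply)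
  qed
qed

lemma diff_finite_hzero: "hzero W \<Longrightarrow> diff_finite W"
  by (rule diff_finiteI[of "{}"]) (simp_all add: Mspan_hzero)

lemma diff_finite_act: "diff_finite W \<Longrightarrow> diff_finite (act p W)"
  by (erule diff_finiteE, rule diff_finiteI, assumption, assumption, assumption, erule Mspan_act)

lemma diff_finite_delta:
  assumes "diff_finite W"
  shows "diff_finite (delta W)"
proof -
  obtain B where B: "finite B" "B \<subseteq> Hol" "\<forall>b\<in>B. delta b \<in> Mspan B" "W \<in> Mspan B"
    using assms unfolding diff_finite_def by (elim exE conjE)
  have "delta W \<in> Mspan B" by (rule Mspan_delta[OF B(2) bspec[OF B(3)] _ B(4)]) (auto intro: Mspan_base)
  from diff_finiteI[OF B(1,2) bspec[OF B(3)] this] show ?thesis .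
qed

lemma diff_finite_add:
  assumes "diff_finite V" "diff_finite W"
  shows "diff_finite (V + W)"
proof -
  obtain B where B: "finite B" "B \<subseteq> Hol" "\<forall>b\<in>B. delta b \<in> Mspan B" "V \<in> Mspan B"
    using assms(1) unfolding diff_finite_def by (elim exE conjE)
  obtain C where C: "finite C" "C \<subseteq> Hol" "\<forall>b\<in>C. delta b \<in> Mspan C" "W \<in> Mspan C"
    using assms(2) unfolding diff_finite_def by (elim exE conjE)
  have sub: "Mspan B \<subseteq> Mspan (B \<union> C)" "Mspan C \<subseteq> Mspan (B \<union> C)" by (intro Mspan_mono; blast)+
  show ?thesis
  proof (rule diff_finiteI)
    show "finite (B \<union> C)" "B \<union> C \<subseteq> Hol" using B C by auto
    show "delta b \<in> Mspan (B \<union> C)" if "b \<in> B \<union> C" for b using B C sub that by blast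
    show "V + W \<in> Mspan (B \<union> C)" using B C sub by (intro Mspan_add) auto
  qed
qed

section \<open>Homogeneous elements and their products\<close>

lemma delta_hsingle: "delta (hsingle k f) = hsingle (k + 2) (serre k f)"
proof (rule ext)
  fix n
  have "n - 2 = k \<longleftrightarrow> n = k + 2" by auto
  then show "delta (hsingle k f) n = hsingle (k + 2) (serre k f) n"
    by (simp add: delta_def hsingle_def serre_zero)
qed

lemma mult_act_hsingle: "mult_act g l (hsingle k f) = hsingle (k + l) (\<lambda>z. f z * g z)"
proof (rule ext)
  fix n
  have "n - l = k \<longleftrightarrow> n = k + l" by auto
  then show "mult_act g l (hsingle k f) n = hsingle (k + l) (\<lambda>z. f z * g z) n"
    by (simp add: mult_act_def hsingle_def mult.commute)
qed

lemma hsingle_in_Hol: "hsingle k f \<in> Hol \<longleftrightarrow> f holomorphic_on uhp"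
  by (auto simp: Hol_def hsingle_def)

primrec serre_iter :: "real \<Rightarrow> (complex \<Rightarrow> complex) \<Rightarrow> nat \<Rightarrow> complex \<Rightarrow> complex" where
  "serre_iter k f 0 = f"
| "serre_iter k f (Suc i) = serre (k + 2 * of_nat i) (serre_iter k f i)"

lemma funpow_delta_hsingle: "(delta ^^ i) (hsingle k f) = hsingle (k + 2 * of_nat i) (serre_iter k f i)"
  by (induction i) (simp_all add: delta_hsingle algebra_simps)

lemma holomorphic_serre_iter: "f holomorphic_on uhp \<Longrightarrow> serre_iter k f i holomorphic_on uhp"
  by (induction i) (simp_all add: holomorphic_serre)

lemma Mspan_mult_act:
  assumes "x \<in> Mspan A" "\<And>a. a \<in> A \<Longrightarrow> mult_act g l a \<in> Mspan B"
  shows "mult_act g l x \<in> Mspan B"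
  using assms(1)
proof (induction rule: Mspan_induct)
  case (zero y)
  then have "hzero (mult_act g l y)" by (simp add: hzero_def mult_act_def)
  then show ?case by (rule Mspan_hzero)
next
  case (base p b y)
  from Mspan_add[OF Mspan_act[OF assms(2)[OF base(1)]] base(2)] show ?case
    by (simp only: mult_act_add mult_act_act)
next
  case (heq y y')
  from Mspan_heq[OF heq(1) heq_mult_act[OF heq(2)]] show ?case .
qed

text \<open>The products of delta^i f and delta^j g with i < N and j < M generate a stable module:
  by Leibniz, \<open>delta\<close> raises one of the two indices, and an index reaching N or M is
  reduced by the recurrence of its factor.\<close>

lemma diff_finite_mult:
  assumes f: "diff_finite (hsingle k f)" and g: "diff_finite (hsingle l g)"
  shows "diff_finite (hsingle (k + l) (\<lambda>z. f z * g z))"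
proof -
  define F where "F i = (delta ^^ i) (hsingle k f)" for i
  define G where "G j = (delta ^^ j) (hsingle l g)" for j
  let ?f = "serre_iter k f" and ?g = "serre_iter l g"
  let ?k = "\<lambda>i. k + 2 * real i" and ?l = "\<lambda>j. l + 2 * real j"
  define P where "P i j = hsingle (?k i + ?l j) (\<lambda>z. ?f i z * ?g j z)" for i j
  \<comment> \<open>The same product is read as a multiple of \<open>F i\<close> and, in
    \<open>PG\<close>, as a multiple of \<open>G j\<close>; multiplication is linear over
    \<open>act\<close>, so either recurrence can be multiplied by the other factor.\<close>
  have PF: "P i j = mult_act (?g j) (?l j) (F i)" for i j
    by (simp only: P_def F_def funpow_delta_hsingle mult_act_hsingle)
  have PG: "P i j = mult_act (?f i) (?k i) (G j)" for i j
    by (simp only: P_def G_def funpow_delta_hsingle mult_act_hsingle mult.commute add.commute)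
  have hol: "?f i holomorphic_on uhp" "?g i holomorphic_on uhp" for i
    using diff_finite_imp_Hol[OF f] diff_finite_imp_Hol[OF g] by (simp_all add: hsingle_in_Hol holomorphic_serre_iter)
  have F_Hol: "F i \<in> Hol" for i
    unfolding F_def by (rule Hol_funpow_delta[OF diff_finite_imp_Hol[OF f]])
  have P_Hol: "P i j \<in> Hol" for i j
    unfolding PF by (rule Hol_mult_act[OF hol(2) F_Hol])
  have delta_P: "heq (delta (P i j)) (P i (Suc j) + P (Suc i) j)" for i j
  proof -
    have "F (Suc i) = delta (F i)" by (simp add: F_def)
    moreover have "?g (Suc j) = serre (?l j) (?g j)" by simp
    moreover have "?l (Suc j) = ?l j + 2" by simp
    ultimately show ?thesis
      unfolding PF using delta_mult_act[OF hol(2) F_Hol, of j "?l j" i] by (simp only:)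
  qed
  obtain N where N: "N > 0" "F N \<in> Mspan (F ` {..<N})"
    using diff_finite_recurrence_pos[OF f] unfolding F_def by (elim exE conjE)
  obtain M where M: "M > 0" "G M \<in> Mspan (G ` {..<M})"
    using diff_finite_recurrence_pos[OF g] unfolding G_def by (elim exE conjE)
  define B where "B = (\<lambda>(i, j). P i j) ` ({..<N} \<times> {..<M})"
  have B: "P i j \<in> Mspan B" if "i < N" "j < M" for i j
    by (rule Mspan_base) (use that in \<open>simp add: B_def image_iff Bex_def, blast\<close>)
  have BN: "P N j \<in> Mspan B" if "j < M" for j
    unfolding PF
  proof (rule Mspan_mult_act[OF N(2)])
    fix a assume "a \<in> F ` {..<N}"
    then obtain i where "i < N" "a = F i" by auto
    then show "mult_act (?g j) (?l j) a \<in> Mspan B" using B[OF _ that, of i] by (simp only: PF)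
  qed
  have BM: "P i M \<in> Mspan B" if "i < N" for i
    unfolding PG
  proof (rule Mspan_mult_act[OF M(2)])
    fix a assume "a \<in> G ` {..<M}"
    then obtain j where "j < M" "a = G j" by auto
    then show "mult_act (?f i) (?k i) a \<in> Mspan B" using B[OF that, of j] by (simp only: PG)
  qed
  have "diff_finite (P 0 0)"
  proof (rule diff_finiteI)
    show "finite B" by (simp add: B_def)
    show "B \<subseteq> Hol" unfolding B_def using P_Hol by (intro image_subsetI) (simp add: case_prod_unfold)
    show "P 0 0 \<in> Mspan B" by (rule B[OF N(1) M(1)])
    show "delta b \<in> Mspan B" if "b \<in> B" for b
    proof -
      from that obtain i j where ij: "i < N" "j < M" "b = P i j" unfolding B_def by auto
      have "P i (Suc j) \<in> Mspan B"
        using B[OF ij(1), of "Suc j"] BM[OF ij(1)] ij(2) by (cases "Suc j = M") simp_all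
      moreover have "P (Suc i) j \<in> Mspan B"
        using B[OF _ ij(2), of "Suc i"] BN[OF ij(2)] ij(1) by (cases "Suc i = N") simp_all
      ultimately show ?thesis
        unfolding ij(3) by (rule Mspan_heq[OF Mspan_add heq_sym[OF delta_P]])
    qed
  qed
  then show ?thesis by (simp add: P_def)
qed

section \<open>The spaces S_k and their closure properties\<close>

lemma sum_hel_apply: "(sum f I :: hel) n z = (\<Sum>i\<in>I. f i n z)"
  by (induction I rule: infinite_finite_induct) simp_all

text \<open>A monic operator of order N kills W exactly when delta^N W is, up to null elements, a
  combination of lower powers; the signs of the coefficients change when passing between the two
  forms.\<close>

lemma Sk_iff_diff_finite: "f \<in> Sk k \<longleftrightarrow> diff_finite (hsingle k f)"
proof
  let ?W = "hsingle k f"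
  assume "f \<in> Sk k"
  then obtain a where hol: "f holomorphic_on uhp" and a: "monic a" "hzero (a ?W)"
    unfolding Sk_def by blast
  from a(1) obtain N m where m: "\<forall>i<N. m i \<in> Mops"
    "a = (\<lambda>h n z. (delta ^^ N) h n z + (\<Sum>i<N. (m i \<circ> delta ^^ i) h n z))"
    unfolding monic_def by (elim exE conjE)
  from m(1) have "\<forall>i. \<exists>p. i < N \<longrightarrow> m i = act p" by (auto simp: Mops_eq_range_act)
  from choice[OF this] obtain p where p: "\<forall>i. i < N \<longrightarrow> m i = act (p i)" ..
  let ?x = "\<Sum>i<N. act (- p i) ((delta ^^ i) ?W)"
  have "?x \<in> Mspan ((\<lambda>i. (delta ^^ i) ?W) ` {..<N})"
    by (rule Mspan_sum, rule Mspan_act, rule Mspan_base, rule imageI)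
  moreover have "heq ?x ((delta ^^ N) ?W)"
    unfolding heq_def
  proof (intro allI ballI)
    fix n z assume z: "z \<in> uhp"
    have "?x n z = - (\<Sum>i<N. act (p i) ((delta ^^ i) ?W) n z)"
      unfolding sum_hel_apply H.scale_minus_left by (simp add: sum_negf)
    also have "(\<Sum>i<N. act (p i) ((delta ^^ i) ?W) n z) = (\<Sum>i<N. (m i \<circ> delta ^^ i) ?W n z)"
      by (rule sum.cong) (simp_all add: p[rule_format])
    also have "- \<dots> = (delta ^^ N) ?W n z"
      using a(2) z unfolding hzero_def m(2) by (simp add: eq_neg_iff_add_eq_0 neg_eq_iff_add_eq_0 add.commute)
    finally show "?x n z = (delta ^^ N) ?W n z" .
  qed
  ultimately have "(delta ^^ N) ?W \<in> Mspan ((\<lambda>i. (delta ^^ i) ?W) ` {..<N})"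
    by (rule Mspan_heq)
  then show "diff_finite ?W"
    by (intro diff_finite_if_recurrence) (simp_all add: hsingle_in_Hol hol)
next
  let ?W = "hsingle k f"
  assume D: "diff_finite ?W"
  from diff_finite_recurrence[OF D] obtain N where N: "(delta ^^ N) ?W \<in> Mspan ((\<lambda>i. (delta ^^ i) ?W) ` {..<N})" ..
  from Mspan_image_finite[OF N] obtain c where c: "heq ((delta ^^ N) ?W) (\<Sum>i<N. act (c i) ((delta ^^ i) ?W))"
    by auto
  define a where "a = (\<lambda>h n z. (delta ^^ N) h n z + (\<Sum>i<N. (act (- c i) \<circ> delta ^^ i) h n z))"
  have "monic a"
    unfolding monic_def
    by (intro exI[of _ N] exI[of _ "\<lambda>i. act (- c i)"] conjI) (simp_all add: act_in_Mops a_def)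
  moreover have "hzero (a ?W)"
    using c unfolding heq_def hzero_def a_def by (simp add: sum_hel_apply sum_negf)
  moreover have "f holomorphic_on uhp" using diff_finite_imp_Hol[OF D] by (simp add: hsingle_in_Hol)
  ultimately show "f \<in> Sk k" unfolding Sk_def by blast
qed

lemma Sk_add: "f \<in> Sk k \<Longrightarrow> g \<in> Sk k \<Longrightarrow> (\<lambda>z. f z + g z) \<in> Sk k"
proof -
  assume "f \<in> Sk k" "g \<in> Sk k"
  then have "diff_finite (hsingle k f + hsingle k g)" unfolding Sk_iff_diff_finite by (rule diff_finite_add)
  also have "hsingle k f + hsingle k g = hsingle k (\<lambda>z. f z + g z)"
    by (simp add: hsingle_def fun_eq_iff)
  finally show ?thesis unfolding Sk_iff_diff_finite .
qed

lemma Sk_zero: "(\<lambda>_. 0) \<in> Sk k"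
  unfolding Sk_iff_diff_finite by (rule diff_finite_hzero) (simp add: hzero_def hsingle_def)

lemma Sk_sum: "(\<And>i. i \<in> I \<Longrightarrow> f i \<in> Sk k) \<Longrightarrow> (\<lambda>z. \<Sum>i\<in>I. f i z) \<in> Sk k"
  by (induction I rule: infinite_finite_induct) (simp_all add: Sk_zero Sk_add)

lemma Sk_mult: "f \<in> Sk k \<Longrightarrow> g \<in> Sk l \<Longrightarrow> (\<lambda>z. f z * g z) \<in> Sk (k + l)"
  unfolding Sk_iff_diff_finite by (rule diff_finite_mult)

lemma Sk_serre: "f \<in> Sk k \<Longrightarrow> serre k f \<in> Sk (k + 2)"
  unfolding Sk_iff_diff_finite using diff_finite_delta[of "hsingle k f"] by (simp only: delta_hsingle)

lemma Sk_smult: "f \<in> Sk k \<Longrightarrow> (\<lambda>z. c * f z) \<in> Sk k"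
proof -
  assume "f \<in> Sk k"
  then have "diff_finite (act [:[:c:]:] (hsingle k f))" unfolding Sk_iff_diff_finite by (rule diff_finite_act)
  also have "act [:[:c:]:] (hsingle k f) = hsingle k (\<lambda>z. c * f z)"
    unfolding act_const by (simp add: hsingle_def scale_act_def fun_eq_iff)
  finally show ?thesis unfolding Sk_iff_diff_finite .
qed

text \<open>In weight 0 the Serre derivative of a constant vanishes, so the constant 1 alone
  generates a stable module.\<close>

lemma Sk_one: "(\<lambda>_. 1) \<in> Sk 0"
  unfolding Sk_iff_diff_finite
proof (rule diff_finiteI)
  show "{hsingle 0 (\<lambda>_. 1)} \<subseteq> Hol" by (simp add: hsingle_in_Hol)
  show "hsingle 0 (\<lambda>_. 1) \<in> Mspan {hsingle 0 (\<lambda>_. 1)}" by (rule Mspan_base) simp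
  show "delta b \<in> Mspan {hsingle 0 (\<lambda>_. 1)}" if "b \<in> {hsingle 0 (\<lambda>_. 1)}" for b
  proof (rule Mspan_hzero)
    have "hzero (delta (hsingle 0 (\<lambda>_. 1)))"
      unfolding delta_hsingle by (simp add: hzero_def hsingle_def serre_def qderiv_def)
    with that show "hzero (delta b)" by simp
  qed
qed simp

text \<open>E4 and E6 arise from 1 by the action of \<open>e4\<close> and \<open>e6\<close>, so they
  lie in the stable module generated by 1.\<close>

lemma Sk_E4: "E4 \<in> Sk 4" and Sk_E6: "E6 \<in> Sk 6"
proof -
  note D = Sk_one[unfolded Sk_iff_diff_finite]
  from diff_finite_act[OF D, of "[:[:0, 1:]:]"] show "E4 \<in> Sk 4"
    unfolding act_e4 e4_eq_mult_act mult_act_hsingle Sk_iff_diff_finite by simp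
  from diff_finite_act[OF D, of "[:0, 1:]"] show "E6 \<in> Sk 6"
    unfolding act_e6 e6_eq_mult_act mult_act_hsingle Sk_iff_diff_finite by simp
qed

lemma Sk_E4_mult: "f \<in> Sk k \<Longrightarrow> (\<lambda>z. E4 z * f z) \<in> Sk (k + 4)"
  and Sk_E6_mult: "f \<in> Sk k \<Longrightarrow> (\<lambda>z. E6 z * f z) \<in> Sk (k + 6)"
  using Sk_mult[OF _ Sk_E4, of f k] Sk_mult[OF _ Sk_E6, of f k] by (simp_all add: mult.commute)

lemma Mk_subset_Sk: "Mk k \<subseteq> Sk k"
proof
  fix f assume "f \<in> Mk k"
  then have "inMk k f" by (simp add: Mk_def)
  then show "f \<in> Sk k"
    by induction (auto intro: Sk_one Sk_E4 Sk_E6 Sk_add Sk_smult Sk_mult)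
qed

text \<open>The whole image is shown to be concentrated in weight k + l. This is what lets the
  induction pass through compositions, where the outer operator is applied to the image of the inner
  one.\<close>

lemma inRk_hsingle:
  assumes "inRk k a" "f \<in> Sk l"
  shows "\<exists>g\<in>Sk (k + l). a (hsingle l f) = hsingle (k + l) g"
  using assms
proof (induction arbitrary: f l rule: inRk.induct)
  case (Rk_gen k a)
  have e4: "e4 (hsingle l f) = hsingle (l + 4) (\<lambda>z. E4 z * f z)"
    unfolding e4_eq_mult_act mult_act_hsingle by (simp add: mult.commute)
  have e6: "e6 (hsingle l f) = hsingle (l + 6) (\<lambda>z. E6 z * f z)"
    unfolding e6_eq_mult_act mult_act_hsingle by (simp add: mult.commute)
  from Rk_gen show ?case
    using Sk_serre Sk_E4_mult Sk_E6_mult by (auto simp: delta_hsingle e4 e6 add.commute)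
next
  case (Rk_add k a b)
  from Rk_add.IH(1)[OF Rk_add.prems] obtain g where g: "g \<in> Sk (k + l)" "a (hsingle l f) = hsingle (k + l) g" ..
  from Rk_add.IH(2)[OF Rk_add.prems] obtain h where h: "h \<in> Sk (k + l)" "b (hsingle l f) = hsingle (k + l) h" ..
  show ?case
    by (rule bexI[OF _ Sk_add[OF g(1) h(1)]]) (unfold op_add_def g h, simp add: hsingle_def fun_eq_iff)
next
  case (Rk_smult k a c)
  from Rk_smult.IH[OF Rk_smult.prems] obtain g where g: "g \<in> Sk (k + l)" "a (hsingle l f) = hsingle (k + l) g" ..
  show ?case
    by (rule bexI[OF _ Sk_smult[OF g(1), of c]]) (unfold op_smult_def g, simp add: hsingle_def fun_eq_iff)
next
  case (Rk_comp i a j b k)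
  from Rk_comp.IH(2)[OF Rk_comp.prems] obtain g where g: "g \<in> Sk (j + l)" "b (hsingle l f) = hsingle (j + l) g" ..
  from Rk_comp.IH(1)[OF g(1)] g(2) Rk_comp.hyps show ?case by (simp add: add.assoc)
qed

section \<open>The direct sum of the S_k\<close>

lemma Ssum_add:
  assumes "h1 \<in> Ssum" "h2 \<in> Ssum"
  shows "(\<lambda>n z. h1 n z + h2 n z) \<in> Ssum"
proof -
  have "{n. (\<lambda>z. h1 n z + h2 n z) \<noteq> (\<lambda>_. 0)} \<subseteq> {n. h1 n \<noteq> (\<lambda>_. 0)} \<union> {n. h2 n \<noteq> (\<lambda>_. 0)}"
    by auto
  then show ?thesis
    using assms by (auto simp: Ssum_def Hspace_def Sk_add intro: finite_subset)
qed

lemma Ssum_smult: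
  assumes "h \<in> Ssum"
  shows "(\<lambda>n z. c * h n z) \<in> Ssum"
proof -
  have "{n. (\<lambda>z. c * h n z) \<noteq> (\<lambda>_. 0)} \<subseteq> {n. h n \<noteq> (\<lambda>_. 0)}" by auto
  then show ?thesis
    using assms by (auto simp: Ssum_def Hspace_def Sk_smult intro: finite_subset)
qed

text \<open>The support of the product lies in the sumset of the two finite supports, and in weight
  n every summand has weight m + (n - m).\<close>

lemma Ssum_hmul:
  assumes "h1 \<in> Ssum" "h2 \<in> Ssum"
  shows "hmul h1 h2 \<in> Ssum"
proof -
  let ?A = "{n. h1 n \<noteq> (\<lambda>_. 0)}" and ?B = "{n. h2 n \<noteq> (\<lambda>_. 0)}"
  have "{n. hmul h1 h2 n \<noteq> (\<lambda>_. 0)} \<subseteq> (\<lambda>(m, n). m + n) ` (?A \<times> ?B)"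
  proof
    fix n assume n: "n \<in> {n. hmul h1 h2 n \<noteq> (\<lambda>_. 0)}"
    have "\<exists>m\<in>?A. h2 (n - m) \<noteq> (\<lambda>_. 0)"
    proof (rule ccontr)
      assume "\<not> (\<exists>m\<in>?A. h2 (n - m) \<noteq> (\<lambda>_. 0))"
      then have "h1 m z * h2 (n - m) z = 0" if "m \<in> ?A" for m z
        using that by (metis mult_zero_right)
      then have "hmul h1 h2 n = (\<lambda>_. 0)"
        unfolding hmul_def by (intro ext sum.neutral ballI)
      with n show False by simp
    qed
    then obtain m where "m \<in> ?A" "n - m \<in> ?B" by blast
    then have "(m, n - m) \<in> ?A \<times> ?B" by blast
    from imageI[OF this, of "\<lambda>(m, n). m + n"] show "n \<in> (\<lambda>(m, n). m + n) ` (?A \<times> ?B)" by simp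
  qed
  moreover have "finite ?A" "finite ?B" using assms by (simp_all add: Ssum_def Hspace_def)
  ultimately have "finite {n. hmul h1 h2 n \<noteq> (\<lambda>_. 0)}"
    using finite_subset by blast
  moreover have "hmul h1 h2 n \<in> Sk n" for n
    unfolding hmul_def
  proof (rule Sk_sum)
    fix m
    have "(\<lambda>z. h1 m z * h2 (n - m) z) \<in> Sk (m + (n - m))"
      using assms by (intro Sk_mult) (simp_all add: Ssum_def)
    then show "(\<lambda>z. h1 m z * h2 (n - m) z) \<in> Sk n" by simp
  qed
  ultimately show ?thesis by (simp add: Ssum_def Hspace_def)
qed

lemma finite_support_shift:
  assumes "finite {n::real. h n \<noteq> z}" "\<And>n. h (n - l) = z \<Longrightarrow> h' n = z'"
  shows "finite {n. h' n \<noteq> z'}"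
proof (rule finite_subset)
  show "{n. h' n \<noteq> z'} \<subseteq> (\<lambda>n. n + l) ` {n. h n \<noteq> z}"
  proof
    fix n assume "n \<in> {n. h' n \<noteq> z'}"
    then have "n - l \<in> {n. h n \<noteq> z}" using assms(2) by blast
    from imageI[OF this, of "\<lambda>n. n + l"] show "n \<in> (\<lambda>n. n + l) ` {n. h n \<noteq> z}" by simp
  qed
qed (use assms(1) in simp)

lemma Ssum_Ralg:
  assumes "a \<in> Ralg" "h \<in> Ssum"
  shows "a h \<in> Ssum"
  using assms
proof (induction arbitrary: h)
  case (R_delta h)
  have "finite {n. delta h n \<noteq> (\<lambda>_. 0)}"
    using R_delta by - (rule finite_support_shift[of h "\<lambda>_. 0" 2], simp_all add: Ssum_def Hspace_def delta_def serre_zero)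
  moreover have "delta h n \<in> Sk n" for n
    using Sk_serre[of "h (n - 2)" "n - 2"] R_delta by (simp add: delta_def Ssum_def)
  ultimately show ?case by (simp add: Ssum_def Hspace_def)
next
  case (R_e4 h)
  have "finite {n. e4 h n \<noteq> (\<lambda>_. 0)}"
    using R_e4 by - (rule finite_support_shift[of h "\<lambda>_. 0" 4], simp_all add: Ssum_def Hspace_def e4_def)
  moreover have "e4 h n \<in> Sk n" for n
    using Sk_E4_mult[of "h (n - 4)" "n - 4"] R_e4 by (simp add: e4_def Ssum_def)
  ultimately show ?case by (simp add: Ssum_def Hspace_def)
next
  case (R_e6 h)
  have "finite {n. e6 h n \<noteq> (\<lambda>_. 0)}"
    using R_e6 by - (rule finite_support_shift[of h "\<lambda>_. 0" 6], simp_all add: Ssum_def Hspace_def e6_def)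
  moreover have "e6 h n \<in> Sk n" for n
    using Sk_E6_mult[of "h (n - 6)" "n - 6"] R_e6 by (simp add: e6_def Ssum_def)
  ultimately show ?case by (simp add: Ssum_def Hspace_def)
qed (simp_all add: op_add_def op_smult_def Ssum_add Ssum_smult)

lemma hone_in_Ssum: "hone \<in> Ssum"
proof -
  have "{n. hone n \<noteq> (\<lambda>_. 0)} \<subseteq> {0}" by (auto simp: hone_def hsingle_def)
  then have "finite {n. hone n \<noteq> (\<lambda>_. 0)}" by (rule finite_subset) simp
  then show ?thesis by (auto simp: Ssum_def Hspace_def hone_def hsingle_def Sk_one Sk_zero)
qed

theorem theorem4p3:
  shows "(\<forall>k f g. f \<in> Sk k \<longrightarrow> g \<in> Sk k \<longrightarrow> (\<lambda>z. f z + g z) \<in> Sk k)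
     \<and> (\<forall>k l f g. f \<in> Sk k \<longrightarrow> g \<in> Sk l \<longrightarrow> (\<lambda>z. f z * g z) \<in> Sk (k + l))
     \<and> (\<forall>k l a f. a \<in> Rk k \<longrightarrow> f \<in> Sk l \<longrightarrow> a (hsingle l f) (k + l) \<in> Sk (k + l))
     \<and> (\<forall>k. Mk k \<subseteq> Sk k)
     \<and> (hone \<in> Ssum
        \<and> (\<forall>h1 h2. h1 \<in> Ssum \<longrightarrow> h2 \<in> Ssum \<longrightarrow> (\<lambda>n z. h1 n z + h2 n z) \<in> Ssum)
        \<and> (\<forall>c h. h \<in> Ssum \<longrightarrow> (\<lambda>n z. c * h n z) \<in> Ssum)
        \<and> (\<forall>h1 h2. h1 \<in> Ssum \<longrightarrow> h2 \<in> Ssum \<longrightarrow> hmul h1 h2 \<in> Ssum)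
        \<and> (\<forall>a h. a \<in> Ralg \<longrightarrow> h \<in> Ssum \<longrightarrow> a h \<in> Ssum))"
proof (intro conjI allI impI)
  fix k l a f assume "a \<in> Rk k" and f: "f \<in> Sk l"
  then have "inRk k a" by (simp add: Rk_def)
  from inRk_hsingle[OF this f]
  obtain g where "g \<in> Sk (k + l)" "a (hsingle l f) = hsingle (k + l) g" ..
  then show "a (hsingle l f) (k + l) \<in> Sk (k + l)" by (simp add: hsingle_def)
qed (simp_all add: Sk_add Sk_mult Mk_subset_Sk hone_in_Ssum Ssum_add Ssum_smult Ssum_hmul Ssum_Ralg)

end
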